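(* Let $f\colon\omega\to\omega$ be a computable block function such that there are only finitely many $f$-types and $f$ is not almost identity. Then the degree spectrum of $f$ on $(\omega,<)$ consists of all $\Delta_2$ Turing degrees.
   Context: A total function $f\colon\omega\to\omega$ is a block function if for every $a\in\omega$ there is a finite interval $I$ of $(\omega,<)$ with $a\in I$, $I$ closed under $f$ (i.e. $f(x)\in I$ for $x\in I$) and closed under $f^{-1}$ (i.e. $f^{-1}(x)\subseteq I$ for $x\in I$). If $I$ is the least such interval (under inclusion), the structure $(I,<,f\upharpoonright I)$ is the $f$-block of $a$, and the isomorphism type of an $f$-block is called an $f$-type. $f$ is almost identity if $f(x)=x$ for all but finitely many $x$. A computable copy of $(\omega,<)$ is $(\omega,\prec)$ with $\prec$ computable and isomorphic to $(\omega,<)$; $f_{\mathcal A}$ is the image of the graph of $f$ in the copy $\mathcal A$ under the isomorphism; the degree spectrum of $f$ is the set of degrees of $f_{\mathcal A}$ over all computable copies $\mathcal A$. *)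

theory Defs
  imports Main "HOL-Library.Nat_Bijection"
begin

section \<open>Relative computability and Turing degrees\<close>

text \<open>
  Kleene's partial recursive functions with an oracle, presented as unary partial functions:
  several arguments are packed into one with the Cantor pairing function \<^const>\<open>prod_encode\<close>.
\<close>

definition pair_op :: "(nat \<rightharpoonup> nat) \<Rightarrow> (nat \<rightharpoonup> nat) \<Rightarrow> (nat \<rightharpoonup> nat)" where
  "pair_op p q n = Option.bind (p n) (\<lambda>a. Option.bind (q n) (\<lambda>b. Some (prod_encode (a, b))))"

definition comp_op :: "(nat \<rightharpoonup> nat) \<Rightarrow> (nat \<rightharpoonup> nat) \<Rightarrow> (nat \<rightharpoonup> nat)" where
  "comp_op p q n = Option.bind (q n) p"

text \<open>
  \<open>r\<langle>a, 0\<rangle> = p a\<close> and \<open>r\<langle>a, k + 1\<rangle> = q\<langle>a, \<langle>k, r\<langle>a, k\<rangle>\<rangle>\<rangle>\<close>.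
\<close>

definition primrec_op :: "(nat \<rightharpoonup> nat) \<Rightarrow> (nat \<rightharpoonup> nat) \<Rightarrow> (nat \<rightharpoonup> nat)" where
  "primrec_op p q n = (case prod_decode n of (a, m) \<Rightarrow>
     rec_nat (p a)
       (\<lambda>k r. Option.bind r (\<lambda>v. q (prod_encode (a, prod_encode (k, v))))) m)"

text \<open>
  Unbounded search: it diverges if a value before the first zero is undefined.
\<close>

definition mu_op :: "(nat \<rightharpoonup> nat) \<Rightarrow> (nat \<rightharpoonup> nat)" where
  "mu_op p a =
     (if \<exists>n. p (prod_encode (a, n)) = Some 0 \<and> (\<forall>m<n. p (prod_encode (a, m)) \<noteq> None)
      then Some (LEAST n. p (prod_encode (a, n)) = Some 0)
      else None)"

inductive partial_recursive_in :: "(nat \<Rightarrow> nat) \<Rightarrow> (nat \<rightharpoonup> nat) \<Rightarrow> bool"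
  for orc :: "nat \<Rightarrow> nat" where
  oracle_call: "partial_recursive_in orc (\<lambda>n. Some (orc n))"
| zero: "partial_recursive_in orc (\<lambda>n. Some 0)"
| successor: "partial_recursive_in orc (\<lambda>n. Some (Suc n))"
| left: "partial_recursive_in orc (\<lambda>n. Some (fst (prod_decode n)))"
| right: "partial_recursive_in orc (\<lambda>n. Some (snd (prod_decode n)))"
| pairing: "\<lbrakk>partial_recursive_in orc p; partial_recursive_in orc q\<rbrakk>
    \<Longrightarrow> partial_recursive_in orc (pair_op p q)"
| composition: "\<lbrakk>partial_recursive_in orc p; partial_recursive_in orc q\<rbrakk>
    \<Longrightarrow> partial_recursive_in orc (comp_op p q)"
| primitive_recursion: "\<lbrakk>partial_recursive_in orc p; partial_recursive_in orc q\<rbrakk>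
    \<Longrightarrow> partial_recursive_in orc (primrec_op p q)"
| minimization: "partial_recursive_in orc p \<Longrightarrow> partial_recursive_in orc (mu_op p)"

definition recursive_in :: "(nat \<Rightarrow> nat) \<Rightarrow> (nat \<Rightarrow> nat) \<Rightarrow> bool" where
  "recursive_in orc f \<longleftrightarrow> partial_recursive_in orc (\<lambda>n. Some (f n))"

definition computable :: "(nat \<Rightarrow> nat) \<Rightarrow> bool" where
  "computable f \<longleftrightarrow> recursive_in (\<lambda>_. 0) f"

definition char_fun :: "nat set \<Rightarrow> nat \<Rightarrow> nat" where
  "char_fun A n = (if n \<in> A then 1 else 0)"

definition computable_set :: "nat set \<Rightarrow> bool" where
  "computable_set A \<longleftrightarrow> computable (char_fun A)"

definition turing_le :: "nat set \<Rightarrow> nat set \<Rightarrow> bool" (infix "\<le>\<^sub>T" 50) where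
  "A \<le>\<^sub>T B \<longleftrightarrow> recursive_in (char_fun B) (char_fun A)"

definition turing_degree :: "nat set \<Rightarrow> nat set set" where
  "turing_degree A = {B. A \<le>\<^sub>T B \<and> B \<le>\<^sub>T A}"

lemma turing_le_refl: "A \<le>\<^sub>T A"
  unfolding turing_le_def recursive_in_def by (rule partial_recursive_in.oracle_call)

lemma partial_recursive_in_trans:
  assumes "partial_recursive_in g p" and "recursive_in h g"
  shows "partial_recursive_in h p"
  using assms(1)
proof induction
  case oracle_call
  then show ?case using assms(2) by (simp add: recursive_in_def)
qed (rule partial_recursive_in.intros; assumption)+

lemma turing_le_trans: "A \<le>\<^sub>T B \<Longrightarrow> B \<le>\<^sub>T C \<Longrightarrow> A \<le>\<^sub>T C"
  unfolding turing_le_def recursive_in_def[of _ "char_fun A"]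
  by (rule partial_recursive_in_trans)

lemma turing_degree_eq_iff: "turing_degree A = turing_degree B \<longleftrightarrow> A \<le>\<^sub>T B \<and> B \<le>\<^sub>T A"
proof
  assume "turing_degree A = turing_degree B"
  moreover have "B \<in> turing_degree B" by (simp add: turing_degree_def turing_le_refl)
  ultimately show "A \<le>\<^sub>T B \<and> B \<le>\<^sub>T A" by (simp add: turing_degree_def set_eq_iff)
next
  assume "A \<le>\<^sub>T B \<and> B \<le>\<^sub>T A"
  then show "turing_degree A = turing_degree B"
    unfolding turing_degree_def by (metis turing_le_trans)
qed

definition sigma2 :: "nat set \<Rightarrow> bool" where
  "sigma2 A \<longleftrightarrow> (\<exists>R. computable_set R \<and>
     A = {x. \<exists>y. \<forall>z. prod_encode (x, prod_encode (y, z)) \<in> R})"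

definition pi2 :: "nat set \<Rightarrow> bool" where
  "pi2 A \<longleftrightarrow> (\<exists>R. computable_set R \<and>
     A = {x. \<forall>y. \<exists>z. prod_encode (x, prod_encode (y, z)) \<in> R})"

definition delta2 :: "nat set \<Rightarrow> bool" where
  "delta2 A \<longleftrightarrow> sigma2 A \<and> pi2 A"

definition delta2_degrees :: "nat set set set" where
  "delta2_degrees = {turing_degree A | A. delta2 A}"


section \<open>Block functions\<close>

definition closed_interval :: "(nat \<Rightarrow> nat) \<Rightarrow> nat set \<Rightarrow> bool" where
  "closed_interval f I \<longleftrightarrow>
     finite I \<and> (\<forall>x\<in>I. \<forall>z\<in>I. \<forall>y. x \<le> y \<and> y \<le> z \<longrightarrow> y \<in> I) \<and>
     (\<forall>x\<in>I. f x \<in> I) \<and> (\<forall>x\<in>I. f -` {x} \<subseteq> I)"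

definition block_function :: "(nat \<Rightarrow> nat) \<Rightarrow> bool" where
  "block_function f \<longleftrightarrow> (\<forall>a. \<exists>I. a \<in> I \<and> closed_interval f I)"

text \<open>
  \<open>LEAST\<close> refers to inclusion here.  A block is represented by its universe \<open>I\<close>; the structure meant
  is \<open>(I, <, f \<restriction> I)\<close>.
\<close>

definition block :: "(nat \<Rightarrow> nat) \<Rightarrow> nat \<Rightarrow> nat set" where
  "block f a = (LEAST I. a \<in> I \<and> closed_interval f I)"

lemma block_least:
  assumes "block_function f"
  shows "a \<in> block f a" "closed_interval f (block f a)"
    "\<And>J. a \<in> J \<Longrightarrow> closed_interval f J \<Longrightarrow> block f a \<subseteq> J"
proof -
  let ?P = "\<lambda>I. a \<in> I \<and> closed_interval f I"
  let ?B = "\<Inter>{I. ?P I}"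
  obtain I where I: "?P I" using assms unfolding block_function_def by blast
  have sub: "?B \<subseteq> J" if "?P J" for J
    using that by (intro Inter_lower CollectI)
  have mem: "x \<in> ?B \<longleftrightarrow> (\<forall>J. ?P J \<longrightarrow> x \<in> J)" for x
    by (simp only: Inter_iff Ball_def mem_Collect_eq)
  have conv: "y \<in> J" if "closed_interval f J" "x \<in> J" "z \<in> J" "x \<le> y \<and> y \<le> z" for J x y z
  proof -
    from that(1) have "\<forall>x\<in>J. \<forall>z\<in>J. \<forall>y. x \<le> y \<and> y \<le> z \<longrightarrow> y \<in> J"
      unfolding closed_interval_def by (elim conjE)
    then show ?thesis using that(2-4) by blast
  qed
  have fwd: "f x \<in> J" if "closed_interval f J" "x \<in> J" for J x
  proof -
    from that(1) have "\<forall>x\<in>J. f x \<in> J"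
      unfolding closed_interval_def by (elim conjE)
    then show ?thesis using that(2) by blast
  qed
  have bwd: "f -` {x} \<subseteq> J" if "closed_interval f J" "x \<in> J" for J x
  proof -
    from that(1) have "\<forall>x\<in>J. f -` {x} \<subseteq> J"
      unfolding closed_interval_def by (elim conjE)
    then show ?thesis using that(2) by blast
  qed
  have "finite I" using I unfolding closed_interval_def by (elim conjE)
  have closed: "closed_interval f ?B"
  proof (rule closed_interval_def[THEN iffD2], intro conjI ballI allI impI)
    show "finite ?B" using sub[OF I] \<open>finite I\<close> by (rule finite_subset)
    show "y \<in> ?B" if "x \<in> ?B" "z \<in> ?B" "x \<le> y \<and> y \<le> z" for x y z
      using that conv unfolding mem by metis
    show "f x \<in> ?B" if "x \<in> ?B" for x
      using that fwd unfolding mem by metis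
    show "f -` {x} \<subseteq> ?B" if "x \<in> ?B" for x
    proof (rule Inter_greatest)
      fix J assume "J \<in> {I. ?P I}"
      then have "?P J" by (rule CollectD)
      with that have "x \<in> J" unfolding mem by metis
      with \<open>?P J\<close> show "f -` {x} \<subseteq> J" using bwd by metis
    qed
  qed
  moreover have "a \<in> ?B" unfolding mem by metis
  ultimately have PB: "?P ?B" by metis
  have eq: "block f a = ?B"
    unfolding block_def using PB sub by (rule Least_equality)
  show "a \<in> block f a" "closed_interval f (block f a)"
    unfolding eq using PB by metis+
  show "block f a \<subseteq> J" if "a \<in> J" "closed_interval f J" for J
    unfolding eq using sub that by metis
qed

definition block_iso :: "(nat \<Rightarrow> nat) \<Rightarrow> (nat set \<times> nat set) set" where
  "block_iso f = {(I, J). I \<in> range (block f) \<and> J \<in> range (block f) \<and>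
     (\<exists>\<phi>. bij_betw \<phi> I J \<and>
          (\<forall>x\<in>I. \<forall>y\<in>I. x < y \<longleftrightarrow> \<phi> x < \<phi> y) \<and>
          (\<forall>x\<in>I. \<phi> (f x) = f (\<phi> x)))}"

definition f_types :: "(nat \<Rightarrow> nat) \<Rightarrow> nat set set set" where
  "f_types f = range (block f) // block_iso f"

definition almost_identity :: "(nat \<Rightarrow> nat) \<Rightarrow> bool" where
  "almost_identity f \<longleftrightarrow> finite {x. f x \<noteq> x}"


section \<open>Computable copies and degree spectra\<close>

definition computable_rel :: "nat rel \<Rightarrow> bool" where
  "computable_rel r \<longleftrightarrow> computable_set (prod_encode ` r)"

definition omega_iso :: "nat rel \<Rightarrow> (nat \<Rightarrow> nat) \<Rightarrow> bool" where
  "omega_iso r h \<longleftrightarrow> bij h \<and> (\<forall>x y. x < y \<longleftrightarrow> (h x, h y) \<in> r)"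

definition graph_image :: "(nat \<Rightarrow> nat) \<Rightarrow> (nat \<Rightarrow> nat) \<Rightarrow> nat rel" where
  "graph_image h f = {(h x, h (f x)) | x. True}"

text \<open>
  The isomorphism of \<open>(\<omega>, <)\<close> onto a copy is unique, so each copy contributes one degree.
\<close>

definition degree_spectrum :: "(nat \<Rightarrow> nat) \<Rightarrow> nat set set set" where
  "degree_spectrum f =
     {turing_degree (prod_encode ` graph_image h f) | r h. computable_rel r \<and> omega_iso r h}"

end

theory Submission
  imports Defs "HOL-Library.Sublist" "HOL-Library.Infinite_Set"
begin

text \<open>
  In a computable copy the number of predecessors of an element seen by stage \<open>t\<close> converges to its
  position, so the image of \<open>f\<close> is a limit of computable approximations.

  Conversely let \<open>A\<close> be the limit of computable guesses.  Cutting \<open>\<omega>\<close> at the points that no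
  edge \<open>x \<mapsto> f x\<close> crosses yields finitely many patterns.  If they do not become constant, there are two
  different words of patterns of equal total size, each occurring infinitely often; if they
  do, \<open>f\<close> is eventually periodic, and one uses the periodic pattern and its shift by one.  Either way a run
  of elements of the copy can be given one pattern or the other, and one can change between
  them arbitrarily often, at most adding elements at both ends of the run.  The run coding \<open>n\<close> changes its
  pattern whenever the guess about \<open>n\<close> changes; after such a change blocks of \<open>f\<close> are
  inserted before each run until it lies at an occurrence of its pattern again.  The pattern of a run
  depends only on the current guess, and inserted blocks keep theirs for ever, so the image of \<open>f\<close> is
  computable from \<open>A\<close>, while \<open>A\<close> is read off one pair of elements in each run.
\<close>

section \<open>Computable functions on pairs and lists\<close>

text \<open>A copy can only grow: elements once placed keep their order for ever, so a run may
  change its pattern only if the new pattern has room for the elements already there. Two words of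
  equal size can be exchanged without adding anything. If one block repeats for ever, words of equal
  size coincide; the run then takes in further periods at both ends, and the shift by one is visible
  on some pair of elements because otherwise \<open>f\<close> would be eventually the identity.

  A run must not remember how often it has changed: patterns of ages of equal parity agree on the
  elements common to both. So the image of \<open>f\<close> can be read off any stage at which the
  run shows the right guess, without knowing when it stops changing.

  Every pattern in use recurs infinitely often, so a displaced run meets an occurrence again when
  blocks are inserted one at a time. Blocks below \<open>i0\<close> may fail to recur and are copied
  literally. New areas are appended at the right end and fillers never change, so only the finitely
  many areas to its left can keep displacing an item; no priority ordering is needed beyond the
  order from left to right.\<close>

class coded =
  fixes enc :: "'a \<Rightarrow> nat" and dec :: "nat \<Rightarrow> 'a"
  assumes dec_enc [simp]: "dec (enc x) = x" and enc_dec [simp]: "enc (dec n) = n"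

instantiation nat :: coded
begin
definition enc_nat :: "nat \<Rightarrow> nat" where [simp]: "enc_nat n = n"
definition dec_nat :: "nat \<Rightarrow> nat" where [simp]: "dec_nat n = n"
instance by standard simp_all
end

instantiation prod :: (coded, coded) coded
begin
definition "enc_prod p = prod_encode (enc (fst p), enc (snd p))"
definition "dec_prod n = (dec (fst (prod_decode n)), dec (snd (prod_decode n)))"
instance by standard (simp_all add: enc_prod_def dec_prod_def)
end

instantiation list :: (coded) coded
begin
definition "enc_list xs = list_encode (map enc xs)"
definition "dec_list n = map dec (list_decode n)"
instance by standard (simp_all add: enc_list_def dec_list_def comp_def)
end

text \<open>The codings are bijections with the naturals, so every number is a code: composition has
  no side conditions on domains, and a search over tuples or lists is a search over numbers.\<close>

definition computable_in :: "(nat \<Rightarrow> nat) \<Rightarrow> ('a::coded \<Rightarrow> 'b::coded) \<Rightarrow> bool" where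
  "computable_in orc f \<longleftrightarrow> recursive_in orc (\<lambda>n. enc (f (dec n)))"

definition decidable_in :: "(nat \<Rightarrow> nat) \<Rightarrow> ('a::coded \<Rightarrow> bool) \<Rightarrow> bool" where
  "decidable_in orc P \<longleftrightarrow> computable_in orc (\<lambda>x. if P x then 1 else 0 :: nat)"

named_theorems comp_intros

lemma computable_in_eqI:
  "(\<And>x. f x = g x) \<Longrightarrow> computable_in orc g \<Longrightarrow> computable_in orc f"
  by (simp add: computable_in_def)

lemma recursive_in_comp:
  "recursive_in orc f \<Longrightarrow> recursive_in orc g \<Longrightarrow> recursive_in orc (\<lambda>n. f (g n))"
  unfolding recursive_in_def
  by (drule (1) partial_recursive_in.composition) (simp add: comp_op_def[abs_def])

lemma recursive_in_pair:
  "recursive_in orc f \<Longrightarrow> recursive_in orc g \<Longrightarrow> recursive_in orc (\<lambda>n. prod_encode (f n, g n))"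
  unfolding recursive_in_def
  by (drule (1) partial_recursive_in.pairing) (simp add: pair_op_def[abs_def])

lemma recursive_in_const: "recursive_in orc (\<lambda>n. c)"
proof (induction c)
  case 0 show ?case unfolding recursive_in_def by (rule partial_recursive_in.zero)
next
  case (Suc c)
  have "recursive_in orc Suc" unfolding recursive_in_def by (rule partial_recursive_in.successor)
  from recursive_in_comp[OF this Suc] show ?case .
qed

lemma recursive_in_fst: "recursive_in orc (\<lambda>n. fst (prod_decode n))"
  unfolding recursive_in_def by (rule partial_recursive_in.left)

lemma recursive_in_snd: "recursive_in orc (\<lambda>n. snd (prod_decode n))"
  unfolding recursive_in_def by (rule partial_recursive_in.right)

lemma recursive_in_id: "recursive_in orc (\<lambda>n. n)"
  using recursive_in_pair[OF recursive_in_fst recursive_in_snd] by simp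

lemma recursive_in_rec:
  assumes "recursive_in orc a" "recursive_in orc c"
  shows "recursive_in orc (\<lambda>n. rec_nat (a (fst (prod_decode n)))
    (\<lambda>k r. c (prod_encode (fst (prod_decode n), prod_encode (k, r)))) (snd (prod_decode n)))"
proof -
  have eq: "rec_nat (Some (a x)) (\<lambda>k r. Option.bind r (\<lambda>v. Some (c (prod_encode (x, prod_encode (k, v)))))) m
    = Some (rec_nat (a x) (\<lambda>k r. c (prod_encode (x, prod_encode (k, r)))) m)" for x m
    by (induction m) simp_all
  from partial_recursive_in.primitive_recursion[OF assms[unfolded recursive_in_def]]
  show ?thesis
    unfolding recursive_in_def primrec_op_def[abs_def] by (simp add: eq split_beta)
qed

lemma recursive_in_Least:
  assumes "recursive_in orc p" "\<And>a. \<exists>n. p (prod_encode (a, n)) = 0"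
  shows "recursive_in orc (\<lambda>a. LEAST n. p (prod_encode (a, n)) = 0)"
  using partial_recursive_in.minimization[OF assms(1)[unfolded recursive_in_def]] assms(2)
  unfolding recursive_in_def mu_op_def[abs_def] by simp

lemma computable_in_id [comp_intros]: "computable_in orc (\<lambda>x. x)"
  by (simp add: computable_in_def recursive_in_id)

lemma computable_in_const [comp_intros]: "computable_in orc (\<lambda>x. c)"
  by (simp add: computable_in_def recursive_in_const)

lemma computable_in_comp:
  "computable_in orc f \<Longrightarrow> computable_in orc g \<Longrightarrow> computable_in orc (\<lambda>x. f (g x))"
  unfolding computable_in_def
  by (drule (1) recursive_in_comp) simp

lemma computable_in_fst_snd:
  "computable_in orc (fst :: 'a::coded \<times> 'b::coded \<Rightarrow> 'a)"
  "computable_in orc (snd :: 'a::coded \<times> 'b::coded \<Rightarrow> 'b)"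
  by (simp_all add: computable_in_def dec_prod_def recursive_in_fst recursive_in_snd)

lemmas computable_in_fst [comp_intros] = computable_in_comp[OF computable_in_fst_snd(1)]
  and computable_in_snd [comp_intros] = computable_in_comp[OF computable_in_fst_snd(2)]

lemma computable_in_Pair [comp_intros]:
  "computable_in orc f \<Longrightarrow> computable_in orc g \<Longrightarrow> computable_in orc (\<lambda>x. (f x, g x))"
  unfolding computable_in_def enc_prod_def by (simp add: recursive_in_pair)

lemma computable_in_comp2:
  assumes "computable_in orc (\<lambda>p. F (fst p) (snd p))" "computable_in orc f" "computable_in orc g"
  shows "computable_in orc (\<lambda>x. F (f x) (g x))"
  using computable_in_comp[OF assms(1) computable_in_Pair[OF assms(2,3)]] by simp

lemma computable_in_Suc [comp_intros]:
  "computable_in orc f \<Longrightarrow> computable_in orc (\<lambda>x. Suc (f x))"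
  by (rule computable_in_comp[of _ Suc])
    (simp_all add: computable_in_def recursive_in_def partial_recursive_in.successor)

text \<open>The body is uncurried over parameter, counter and previous value, so that
  \<open>comp_intros\<close> can descend into it as into any function of one variable.\<close>

lemma computable_in_rec_nat [comp_intros]:
  assumes "computable_in orc a" "computable_in orc m"
    "computable_in orc (\<lambda>p. c (fst p) (fst (snd p)) (snd (snd p)))"
  shows "computable_in orc (\<lambda>x. rec_nat (a x) (\<lambda>k r. c x k r) (m x))"
proof -
  have ind: "enc (rec_nat (a x) (c x) m)
    = rec_nat (enc (a x)) (\<lambda>k r. enc (c x k (dec r))) m" for x m
    by (induction m) (simp_all, metis dec_enc)
  from recursive_in_rec[OF assms(1,3)[unfolded computable_in_def]]
  have "computable_in orc (\<lambda>(x, m). rec_nat (a x) (c x) m)"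
    unfolding computable_in_def by (simp add: dec_prod_def split_beta ind)
  from computable_in_comp[OF this computable_in_Pair[OF computable_in_id assms(2)]]
  show ?thesis by simp
qed

lemma computable_in_pred: "computable_in orc f \<Longrightarrow> computable_in orc (\<lambda>x. f x - 1 :: nat)"
proof -
  have "n - 1 = rec_nat 0 (\<lambda>k r. k) n" for n :: nat by (cases n) simp_all
  then show "computable_in orc f \<Longrightarrow> ?thesis" by (simp only:) (intro comp_intros)
qed

lemma computable_in_add [comp_intros]:
  assumes "computable_in orc f" "computable_in orc g"
  shows "computable_in orc (\<lambda>x. f x + g x :: nat)"
proof -
  have "a + b = rec_nat a (\<lambda>k r. Suc r) b" for a b :: nat by (induction b) simp_all
  then show ?thesis by (simp only:) (intro comp_intros assms)
qed

lemma computable_in_diff [comp_intros]: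
  assumes "computable_in orc f" "computable_in orc g"
  shows "computable_in orc (\<lambda>x. f x - g x :: nat)"
proof -
  have "a - b = rec_nat a (\<lambda>k r. r - 1) b" for a b :: nat by (induction b) simp_all
  then show ?thesis by (rule computable_in_eqI) (intro comp_intros computable_in_pred assms)
qed

lemma computable_in_mult [comp_intros]:
  assumes "computable_in orc f" "computable_in orc g"
  shows "computable_in orc (\<lambda>x. f x * g x :: nat)"
proof -
  have "a * b = rec_nat 0 (\<lambda>k r. r + a) b" for a b :: nat by (induction b) simp_all
  then show ?thesis by (simp only:) (intro comp_intros assms assms[THEN computable_in_comp])
qed

lemma computable_in_decidable [comp_intros]:
  "decidable_in orc P \<Longrightarrow> computable_in orc (\<lambda>x. if P x then 1 else 0 :: nat)"
  by (simp add: decidable_in_def)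

lemma computable_in_If [comp_intros]:
  assumes "decidable_in orc P" "computable_in orc f" "computable_in orc g"
  shows "computable_in orc (\<lambda>x. if P x then f x else g x)"
proof -
  have "(if P x then f x else g x) = rec_nat (g x) (\<lambda>k r. f x) (if P x then 1 else 0)" for x
    by simp
  then show ?thesis
    by (rule computable_in_eqI) (intro comp_intros assms assms(2)[THEN computable_in_comp])
qed

lemma decidable_in_not [comp_intros]:
  assumes "decidable_in orc P" shows "decidable_in orc (\<lambda>x. \<not> P x)"
proof -
  have "(if \<not> P x then 1 else 0) = (if P x then 0 else 1 :: nat)" for x by simp
  then show ?thesis unfolding decidable_in_def[of _ "\<lambda>x. \<not> P x"]
    by (simp only:) (intro comp_intros assms)
qed

lemma decidable_in_conj [comp_intros]:
  assumes "decidable_in orc P" "decidable_in orc Q" shows "decidable_in orc (\<lambda>x. P x \<and> Q x)"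
proof -
  have "(if P x \<and> Q x then 1 else 0) = (if P x then if Q x then 1 else 0 else 0 :: nat)" for x by simp
  then show ?thesis unfolding decidable_in_def[of _ "\<lambda>x. P x \<and> Q x"]
    by (simp only:) (intro comp_intros assms)
qed

lemma decidable_in_disj [comp_intros]:
  assumes "decidable_in orc P" "decidable_in orc Q" shows "decidable_in orc (\<lambda>x. P x \<or> Q x)"
proof -
  have "(P x \<or> Q x) = (\<not> (\<not> P x \<and> \<not> Q x))" for x by simp
  then show ?thesis by (simp only:) (intro comp_intros assms)
qed

lemma decidable_in_imp [comp_intros]:
  assumes "decidable_in orc P" "decidable_in orc Q" shows "decidable_in orc (\<lambda>x. P x \<longrightarrow> Q x)"
proof -
  have "(P x \<longrightarrow> Q x) = (\<not> P x \<or> Q x)" for x by simp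
  then show ?thesis by (simp only:) (intro comp_intros assms)
qed

lemma decidable_in_iff [comp_intros]:
  assumes "decidable_in orc P" "decidable_in orc Q" shows "decidable_in orc (\<lambda>x. P x \<longleftrightarrow> Q x)"
proof -
  have "(P x \<longleftrightarrow> Q x) = ((P x \<longrightarrow> Q x) \<and> (Q x \<longrightarrow> P x))" for x by blast
  then show ?thesis by (simp only:) (intro comp_intros assms)
qed

lemma decidable_in_comp:
  "decidable_in orc P \<Longrightarrow> computable_in orc g \<Longrightarrow> decidable_in orc (\<lambda>x. P (g x))"
  unfolding decidable_in_def by (rule computable_in_comp)

lemma decidable_in_le [comp_intros]:
  assumes "computable_in orc f" "computable_in orc g"
  shows "decidable_in orc (\<lambda>x. f x \<le> (g x :: nat))"
proof -
  have "(if f x \<le> g x then 1 else 0) = 1 - (f x - g x :: nat)" for x by simp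
  then show ?thesis unfolding decidable_in_def
    by (simp only:) (intro comp_intros assms assms[THEN computable_in_comp])
qed

lemma decidable_in_less [comp_intros]:
  assumes "computable_in orc f" "computable_in orc g"
  shows "decidable_in orc (\<lambda>x. f x < (g x :: nat))"
proof -
  have "(f x < g x) = (\<not> g x \<le> f x)" for x by auto
  then show ?thesis by (simp only:) (intro comp_intros assms assms[THEN computable_in_comp])
qed

lemma computable_in_enc:
  "computable_in orc f \<Longrightarrow> computable_in orc (\<lambda>x. enc (f x))"
  unfolding computable_in_def by simp

lemma computable_in_dec:
  "computable_in orc f \<Longrightarrow> computable_in orc (\<lambda>x. dec (f x))"
  unfolding computable_in_def by simp

lemma decidable_in_eq [comp_intros]:
  assumes "computable_in orc f" "computable_in orc g"
  shows "decidable_in orc (\<lambda>x. f x = g x)"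
proof -
  have "(f x = g x) = (enc (f x) \<le> enc (g x) \<and> enc (g x) \<le> enc (f x))" for x
    by (metis dec_enc order_antisym order_refl)
  then show ?thesis by (simp only:) (intro comp_intros computable_in_enc assms)
qed

lemma decidable_in_all_less [comp_intros]:
  fixes b :: "'a::coded \<Rightarrow> nat"
  assumes "computable_in orc b" "decidable_in orc (\<lambda>p. P (fst p) (snd p))"
  shows "decidable_in orc (\<lambda>x. \<forall>k<b x. P x k)"
proof -
  have eq: "(if \<forall>k<n. P x k then 1 else 0) = rec_nat 1 (\<lambda>k r. if P x k then r else 0 :: nat) n" for x n
    by (induction n) (auto simp: less_Suc_eq)
  have "decidable_in orc (\<lambda>p :: 'a \<times> nat \<times> nat. P (fst p) (fst (snd p)))"
    by (rule decidable_in_comp[OF assms(2), of "\<lambda>p :: 'a \<times> nat \<times> nat. (fst p, fst (snd p))",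
        unfolded fst_conv snd_conv]) (intro comp_intros)
  then show ?thesis unfolding decidable_in_def[of _ "\<lambda>x. \<forall>k<b x. P x k"] eq
    by (intro comp_intros assms)
qed

lemma computable_in_Least [comp_intros]:
  fixes P :: "'a::coded \<Rightarrow> nat \<Rightarrow> bool"
  assumes "decidable_in orc (\<lambda>p. P (fst p) (snd p))" "\<And>x. \<exists>n. P x n"
  shows "computable_in orc (\<lambda>x. LEAST n. P x n)"
proof -
  let ?p = "\<lambda>p. if P (fst p) (snd p) then 0 else 1 :: nat"
  have "computable_in orc ?p" by (intro comp_intros assms)
  then have "recursive_in orc (\<lambda>a. LEAST n. (\<lambda>q. ?p (dec q)) (prod_encode (a, n)) = 0)"
    unfolding computable_in_def enc_nat_def
    by (rule recursive_in_Least) (use assms(2) in \<open>auto simp: dec_prod_def\<close>)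
  moreover have "(if Q then 0 else 1 :: nat) = 0 \<longleftrightarrow> Q" for Q by simp
  ultimately show ?thesis by (simp add: computable_in_def dec_prod_def del: One_nat_def)
qed

lemma computable_in_mod2 [comp_intros]:
  assumes "computable_in orc f" shows "computable_in orc (\<lambda>x. f x mod 2 :: nat)"
proof -
  have "n mod 2 = rec_nat 0 (\<lambda>k r. 1 - r) n" for n :: nat
  proof (induction n)
    case (Suc n)
    have "Suc n mod 2 = 1 - n mod 2" by presburger
    also have "\<dots> = rec_nat 0 (\<lambda>k r. 1 - r) (Suc n)" using Suc by simp
    finally show ?case .
  qed simp
  then show ?thesis by (simp only:) (intro comp_intros assms assms[THEN computable_in_comp])
qed

lemma decidable_in_even [comp_intros]:
  fixes f :: "'a::coded \<Rightarrow> nat"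
  assumes "computable_in orc f" shows "decidable_in orc (\<lambda>x. even (f x))"
  unfolding even_iff_mod_2_eq_zero by (intro comp_intros assms assms[THEN computable_in_comp])

section \<open>Computability of list operations\<close>

lemma enc_Cons: "enc (x # xs) = Suc (prod_encode (enc x, enc xs))"
  by (simp add: enc_list_def)

lemma computable_in_Cons [comp_intros]:
  "computable_in orc f \<Longrightarrow> computable_in orc g \<Longrightarrow> computable_in orc (\<lambda>x. f x # g x)"
proof -
  assume a: "computable_in orc f" "computable_in orc g"
  have "computable_in orc (\<lambda>x. dec (Suc (enc (f x, g x))) :: 'b list)"
    by (intro comp_intros computable_in_dec computable_in_enc a)
  moreover have "dec (Suc (enc (f x, g x))) = f x # g x" for x
    by (metis enc_Cons dec_enc enc_prod_def fst_conv snd_conv)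
  ultimately show ?thesis by simp
qed

lemma computable_in_hd [comp_intros]:
  fixes f :: "'a::coded \<Rightarrow> 'b::coded list"
  assumes "computable_in orc f" shows "computable_in orc (\<lambda>x. hd (f x))"
proof -
  have "hd xs = (if xs = [] then hd [] else fst (dec (enc xs - 1) :: 'b \<times> 'b list))" for xs :: "'b list"
    by (cases xs) (simp_all add: enc_Cons dec_prod_def)
  then show ?thesis
    by (rule computable_in_eqI) (intro comp_intros computable_in_dec computable_in_enc assms)
qed

lemma computable_in_tl [comp_intros]:
  fixes f :: "'a::coded \<Rightarrow> 'b::coded list"
  assumes "computable_in orc f" shows "computable_in orc (\<lambda>x. tl (f x))"
proof -
  have "tl xs = (if xs = [] then [] else snd (dec (enc xs - 1) :: 'b \<times> 'b list))" for xs :: "'b list"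
    by (cases xs) (simp_all add: enc_Cons dec_prod_def)
  then show ?thesis
    by (simp only:) (intro comp_intros computable_in_dec computable_in_enc assms)
qed

lemma length_le_enc: "length xs \<le> enc xs"
proof (induction xs)
  case (Cons x xs)
  then show ?case by (simp add: enc_Cons) (metis le_prod_encode_2 order_trans)
qed simp

lemma computable_in_foldl [comp_intros]:
  assumes "computable_in orc a" "computable_in orc l"
    "computable_in orc (\<lambda>p. c (fst p) (fst (snd p)) (snd (snd p)))"
  shows "computable_in orc (\<lambda>x. foldl (\<lambda>r y. c x r y) (a x) (l x))"
proof -
  let ?step = "\<lambda>x k (r :: 'b \<times> 'c list). if snd r = [] then r else (c x (fst r) (hd (snd r)), tl (snd r))"
  have iter: "rec_nat (r, xs) (?step x) n = (foldl (c x) r (take n xs), drop n xs)" for x r xs n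
  proof (induction n)
    case (Suc n)
    show ?case
    proof (cases "n < length xs")
      case True
      then show ?thesis using Suc
        by (simp add: take_Suc_conv_app_nth hd_drop_conv_nth drop_Suc tl_drop)
    next
      case False then show ?thesis using Suc by simp
    qed
  qed simp
  \<comment> \<open>The number of rounds is the code of the list, which bounds its length; the
    computability of the length itself is only derived from folds. Surplus rounds leave the state
    unchanged.\<close>
  have eq: "foldl (c x) (a x) (l x) = fst (rec_nat (a x, l x) (?step x) (enc (l x)))" for x
    using length_le_enc[of "l x"] by (simp add: iter)
  have "computable_in orc (\<lambda>p :: 'a \<times> nat \<times> 'b \<times> 'c list.
      (fst p, fst (snd (snd p)), hd (snd (snd (snd p)))))"
    by (intro comp_intros)
  note 1 = computable_in_comp[OF assms(3) this, unfolded fst_conv snd_conv]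
  show ?thesis unfolding eq
    by (intro comp_intros computable_in_enc assms 1)
qed

lemma computable_in_rev [comp_intros]:
  assumes "computable_in orc f" shows "computable_in orc (\<lambda>x. rev (f x))"
proof -
  have "rev xs = foldl (\<lambda>r y. y # r) [] xs" for xs :: "'c list"
    by (simp add: foldl_conv_fold rev_conv_fold)
  then show ?thesis by (rule computable_in_eqI) (intro comp_intros assms assms[THEN computable_in_comp])
qed

lemma computable_in_append [comp_intros]:
  assumes "computable_in orc f" "computable_in orc g"
  shows "computable_in orc (\<lambda>x. f x @ g x)"
proof -
  have "xs @ ys = foldl (\<lambda>r y. y # r) ys (rev xs)" for xs ys :: "'c list"
    by (simp add: foldl_conv_fold fold_Cons_rev)
  then show ?thesis by (rule computable_in_eqI) (intro comp_intros assms assms[THEN computable_in_comp])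
qed

lemma computable_in_length [comp_intros]:
  fixes f :: "'a::coded \<Rightarrow> 'b::coded list"
  assumes "computable_in orc f" shows "computable_in orc (\<lambda>x. length (f x))"
proof -
  have "length xs = foldl (\<lambda>r y. Suc r) 0 xs" for xs :: "'b list"
    by (induction xs rule: rev_induct) simp_all
  then show ?thesis by (rule computable_in_eqI) (intro comp_intros assms assms[THEN computable_in_comp])
qed

text \<open>\<open>hd (drop k xs)\<close> serves as the computable form of \<open>xs ! k\<close>
  below.\<close>

lemma computable_in_drop [comp_intros]:
  assumes "computable_in orc n" "computable_in orc f"
  shows "computable_in orc (\<lambda>x. drop (n x) (f x))"
proof -
  have "drop k xs = rec_nat xs (\<lambda>k r. tl r) k" for k and xs :: "'c list"
    by (induction k) (simp_all add: drop_Suc flip: tl_drop)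
  then show ?thesis by (rule computable_in_eqI) (intro comp_intros assms assms[THEN computable_in_comp])
qed

lemma computable_in_upt [comp_intros]:
  assumes "computable_in orc f" "computable_in orc g"
  shows "computable_in orc (\<lambda>x. [f x..<g x])"
proof -
  have "[i..<i + n] = rec_nat [] (\<lambda>k r. r @ [i + k]) n" for i n by (induction n) simp_all
  note this[of i "j - i" for i j]
  then have "[i..<j] = rec_nat [] (\<lambda>k r. r @ [i + k]) (j - i)" for i j
    by (cases "i \<le> j") (simp_all, metis le_add_diff_inverse)
  then show ?thesis by (rule computable_in_eqI) (intro comp_intros assms assms[THEN computable_in_comp])
qed

lemma computable_in_mono:
  assumes "computable_in (\<lambda>_. 0) f" shows "computable_in orc f"
  using assms recursive_in_const[of orc 0]
  unfolding computable_in_def recursive_in_def[of _ "\<lambda>n. enc (f (dec n))"]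
  by (rule partial_recursive_in_trans)

lemma decidable_in_mono:
  "decidable_in (\<lambda>_. 0) P \<Longrightarrow> decidable_in orc P"
  unfolding decidable_in_def by (rule computable_in_mono)

section \<open>Boundaries and recurrent patterns\<close>

definition recurrent_word :: "(nat \<Rightarrow> 'a) \<Rightarrow> nat \<Rightarrow> nat \<Rightarrow> bool" where
  "recurrent_word T i l \<longleftrightarrow> infinite {p. \<forall>t<l. T (p + t) = T (i + t)}"

lemma recurrent_word_mono:
  "recurrent_word T i l \<Longrightarrow> j + m \<le> l \<Longrightarrow> recurrent_word T (i + j) m"
proof -
  assume a: "recurrent_word T i l" "j + m \<le> l"
  let ?S = "{p. \<forall>t<l. T (p + t) = T (i + t)}"
  have "(\<lambda>p. p + j) ` ?S \<subseteq> {p. \<forall>t<m. T (p + t) = T (i + j + t)}"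
    using a(2) by (auto simp: add.assoc)
  moreover have "infinite ((\<lambda>p. p + j) ` ?S)"
    using a(1) unfolding recurrent_word_def by (subst finite_image_iff) (auto intro: inj_onI)
  ultimately show ?thesis unfolding recurrent_word_def using finite_subset by blast
qed

text \<open>There are finitely many words of length \<open>l\<close>, and those with finitely many
  occurrences occupy finitely many positions; \<open>i0\<close> lies beyond all of these.\<close>

lemma eventually_recurrent_word:
  assumes "finite (range T)"
  shows "\<exists>i0. \<forall>i\<ge>i0. recurrent_word T i l"
proof -
  define F where "F i = map (\<lambda>t. T (i + t)) [0..<l]" for i
  have eq: "F p = F i \<longleftrightarrow> (\<forall>t<l. T (p + t) = T (i + t))" for p i
    by (auto simp: F_def)
  have "range F \<subseteq> {xs. set xs \<subseteq> range T \<and> length xs = l}" by (auto simp: F_def)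
  then have fin: "finite (range F)"
    using finite_lists_length_eq[OF assms] finite_subset by blast
  define B where "B = (\<Union>w\<in>{w \<in> range F. finite (F -` {w})}. F -` {w})"
  have "finite B" unfolding B_def using fin by auto
  then obtain i0 where i0: "\<forall>i\<in>B. i < i0" unfolding finite_nat_set_iff_bounded by metis
  have "recurrent_word T i l" if "i \<ge> i0" for i
  proof -
    have "i \<notin> B" using i0 that by (metis linorder_not_le)
    then have "infinite (F -` {F i})" unfolding B_def by auto
    then show ?thesis unfolding recurrent_word_def by (simp add: vimage_def eq)
  qed
  then show ?thesis by blast
qed

lemma equal_letters_between:
  assumes same: "\<And>t. t < l \<Longrightarrow> T (i + t) = T (Suc i + t)"
  shows "t \<le> l \<Longrightarrow> T (i + t) = T i"
proof (induction t)
  case (Suc t)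
  then show ?case using same[of t] by simp
qed simp

lemma sum_Suc_shift:
  fixes g :: "nat \<Rightarrow> nat"
  assumes "g i = g (i + l)"
  shows "(\<Sum>t<l. g (Suc i + t)) = (\<Sum>t<l. g (i + t))"
proof -
  have "(\<Sum>t<Suc l. g (i + t)) = (\<Sum>t<l. g (i + t)) + g (i + l)" by simp
  moreover have "(\<Sum>t<Suc l. g (i + t)) = g i + (\<Sum>t<l. g (Suc i + t))"
    by (subst sum.lessThan_Suc_shift) simp
  ultimately show ?thesis using assms by simp
qed

text \<open>
  If equal total sizes forced equal words, then between two close occurrences of a letter \<open>X\<close> only
  \<open>X\<close> could occur (\<open>X w\<close> and \<open>w X\<close> have the same size when \<open>X w X\<close> is recurrent), so every long
  window would contain a long constant run.  Runs of distinct letters \<open>Y\<close>, \<open>Z\<close> then give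
  the words \<open>Y\<^bsup>|Z|\<^esup>\<close> and \<open>Z\<^bsup>|Y|\<^esup>\<close>.
\<close>

lemma word_dichotomy:
  fixes T :: "nat \<Rightarrow> 'a" and sz :: "'a \<Rightarrow> nat"
  assumes fin: "finite (range T)" and pos: "\<And>i. sz (T i) > 0"
    and nonconst: "\<not> (\<exists>i0. \<forall>i\<ge>i0. T i = T i0)"
  shows "\<exists>i i' l l' t. t < l \<and> t < l' \<and> T (i + t) \<noteq> T (i' + t) \<and>
    (\<Sum>u<l. sz (T (i + u))) = (\<Sum>u<l'. sz (T (i' + u))) \<and>
    recurrent_word T i l \<and> recurrent_word T i' l'"
proof (rule ccontr)
  assume neg: "\<not> ?thesis"
  have none: False if "t < l" "t < l'" "T (i + t) \<noteq> T (i' + t)"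
    "(\<Sum>u<l. sz (T (i + u))) = (\<Sum>u<l'. sz (T (i' + u)))"
    "recurrent_word T i l" "recurrent_word T i' l'" for i i' l l' t
    using neg that by blast
  define K where "K = Max (range (\<lambda>i. sz (T i)))"
  have finK: "finite (range (\<lambda>i. sz (T i)))"
    using finite_imageI[OF fin, of sz] by (simp add: image_image)
  have K: "sz (T i) \<le> K" for i unfolding K_def using finK by (intro Max_ge) auto
  then have Kpos: "K > 0" using pos[of 0] order_less_le_trans by blast
  \<comment> \<open>By pigeonhole, one of the letters occurs at least \<open>K\<close> times among
    \<open>L\<close> consecutive ones. As \<open>K\<close> bounds all sizes, a constant run of
    length \<open>K\<close> contains the powers needed at the end.\<close>
  define L where "L = card (range T) * K"
  obtain i0 where i0: "\<And>i. i \<ge> i0 \<Longrightarrow> recurrent_word T i (Suc L)"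
    using eventually_recurrent_word[OF fin] by blast
  have rec: "recurrent_word T i l" if "i \<ge> i0" "l \<le> Suc L" for i l
    using recurrent_word_mono[OF i0[OF that(1)], of 0 l] that(2) by simp
  have between: "T (i + t) = T i" if "i \<ge> i0" "l \<le> L" "T (i + l) = T i" "t \<le> l" for i l t
  proof (rule equal_letters_between[OF _ that(4)])
    fix t assume "t < l"
    show "T (i + t) = T (Suc i + t)"
    proof (rule ccontr)
      assume "T (i + t) \<noteq> T (Suc i + t)"
      moreover have "(\<Sum>u<l. sz (T (i + u))) = (\<Sum>u<l. sz (T (Suc i + u)))"
        by (rule sum_Suc_shift[symmetric]) (simp add: that(3))
      moreover have "recurrent_word T i l" "recurrent_word T (Suc i) l"
        using that(1,2) by (auto intro!: rec)
      ultimately show False using none[of t l l i "Suc i"] \<open>t < l\<close> by simp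
    qed
  qed
  have run: "\<exists>a\<ge>i. a + K \<le> i + L \<and> (\<forall>t<K. T (a + t) = T a)" if "i \<ge> i0" for i
  proof -
    let ?W = "{i..<i + L}"
    have "\<exists>y\<in>range T. K \<le> card (T -` {y} \<inter> ?W)"
    proof (rule ccontr)
      assume "\<not> ?thesis"
      then have less: "card (T -` {y} \<inter> ?W) < K" if "y \<in> range T" for y
        using that by (meson not_le)
      have "?W = (\<Union>y\<in>range T. T -` {y} \<inter> ?W)" by auto
      then have "card ?W = card (\<Union>y\<in>range T. T -` {y} \<inter> ?W)" by simp
      also have "\<dots> \<le> (\<Sum>y\<in>range T. card (T -` {y} \<inter> ?W))" by (rule card_UN_le[OF fin])
      also have "\<dots> < card (range T) * K"
        using sum_bounded_above_strict[of "range T" _ K] less fin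
        by (simp add: card_gt_0_iff)
      finally show False by (simp add: L_def)
    qed
    then obtain y where cardK: "K \<le> card (T -` {y} \<inter> ?W)" (is "_ \<le> card ?C") by blast
    have finC: "finite ?C" by simp
    have "?C \<noteq> {}" using cardK Kpos by auto
    define a b where "a = Min ?C" and "b = Max ?C"
    have a: "a \<in> ?C" and b: "b \<in> ?C"
      unfolding a_def b_def by (rule Min_in Max_in, rule finC, rule \<open>?C \<noteq> {}\<close>)+
    have "?C \<subseteq> {a..b}" using finC unfolding a_def b_def by auto
    then have "card ?C \<le> Suc b - a" using card_mono[of "{a..b}" ?C] by simp
    then have len: "a + K \<le> Suc b" using cardK Kpos by simp
    have "T (a + t) = T a" if "t < K" for t
    proof (rule between[of a "b - a"])
      show "a \<ge> i0" "b - a \<le> L" using a b \<open>i \<ge> i0\<close> by auto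
      have "a \<le> b" using finC a unfolding b_def by simp
      then show "T (a + (b - a)) = T a" using a b by simp
      show "t \<le> b - a" using len that by simp
    qed
    then show ?thesis using a b len by (intro exI[of _ a]) auto
  qed
  obtain a where a: "a \<ge> i0" "\<forall>t<K. T (a + t) = T a" using run[of i0] by auto
  obtain e' where "e' \<ge> a" "T e' \<noteq> T a" using nonconst by blast
  then have ex: "T (a + (e' - a)) \<noteq> T a" by simp
  define d where "d = (LEAST d. T (a + d) \<noteq> T a)"
  have d: "T (a + d) \<noteq> T a" unfolding d_def using ex by (rule LeastI)
  have "d \<noteq> 0" using d by (cases d) auto
  then obtain c where c: "d = Suc c" by (cases d) auto
  have Tc: "T (a + c) = T a" using not_less_Least[of c "\<lambda>d. T (a + d) \<noteq> T a"] c d_def by auto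
  \<comment> \<open>\<open>e\<close> is the last position of the run of \<open>T a\<close>. A return
    to this letter within \<open>L\<close> steps would give \<open>T (e + 1) = T e\<close> by
    \<open>between\<close>, so the next long run consists of another letter.\<close>
  define e where "e = a + c"
  obtain a' where a': "a' \<ge> Suc e" "a' + K \<le> Suc e + L" "\<forall>t<K. T (a' + t) = T a'"
    using run[of "Suc e"] a e_def by auto
  have "T a' \<noteq> T a"
  proof
    assume "T a' = T a"
    then have "T (e + (a' - e)) = T e" using a' Tc e_def by simp
    then have "T (e + 1) = T e" using between[of e "a' - e" 1] a a' Kpos e_def by auto
    then show False using d c e_def Tc by simp
  qed
  let ?l = "sz (T a')" and ?l' = "sz (T a)"
  have "(\<Sum>u<?l. sz (T (a + u))) = (\<Sum>u<?l. sz (T a))"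
    using a(2) K[of a'] by (intro sum.cong) auto
  moreover have "(\<Sum>u<?l'. sz (T (a' + u))) = (\<Sum>u<?l'. sz (T a'))"
    using a'(3) K[of a] by (intro sum.cong) auto
  ultimately have "(\<Sum>u<?l. sz (T (a + u))) = (\<Sum>u<?l'. sz (T (a' + u)))" by simp
  moreover have "K \<le> L" using fin by (simp add: L_def card_gt_0_iff Suc_leI)
  moreover have "recurrent_word T a ?l" "recurrent_word T a' ?l'"
    using \<open>K \<le> L\<close> K[of a] K[of a'] a(1) a'(1) e_def by (auto intro!: rec)
  ultimately show False
    using none[of 0 ?l ?l' a a'] pos[of a] pos[of a'] \<open>T a' \<noteq> T a\<close> by simp
qed


section \<open>Boundaries of a block function\<close>

definition boundary :: "(nat \<Rightarrow> nat) \<Rightarrow> nat \<Rightarrow> bool" where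
  "boundary f q \<longleftrightarrow> (\<forall>x. f x < q \<longleftrightarrow> x < q)"

text \<open>Isomorphic blocks have the same size, so there is one size per type. This is where the
  finiteness of the set of types enters.\<close>

lemma block_card_bounded:
  assumes "block_function f" "finite (f_types f)"
  shows "\<exists>M. \<forall>a. card (block f a) \<le> M"
proof -
  have card_eq: "card J = card I" if "(I, J) \<in> block_iso f" for I J
    using that unfolding block_iso_def by (auto dest: bij_betw_same_card)
  have refl: "(block f a, block f a) \<in> block_iso f" for a
    unfolding block_iso_def by (simp, intro exI[of _ id]) simp
  have "card (block f a) \<in> (\<lambda>C. card (SOME J. J \<in> C)) ` f_types f" for a
  proof (rule image_eqI)
    let ?C = "block_iso f `` {block f a}"
    show "?C \<in> f_types f" unfolding f_types_def by (rule quotientI) simp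
    have "block f a \<in> ?C" using refl by simp
    then have "(SOME J. J \<in> ?C) \<in> ?C" by (rule someI)
    then show "card (block f a) = card (SOME J. J \<in> ?C)" using card_eq by (metis Image_singleton_iff)
  qed
  then have "range (\<lambda>a. card (block f a)) \<subseteq> (\<lambda>C. card (SOME J. J \<in> C)) ` f_types f" by blast
  then have "finite (range (\<lambda>a. card (block f a)))" using assms(2) finite_subset by blast
  then show ?thesis unfolding finite_nat_set_iff_bounded_le by auto
qed

lemma closed_intervalD:
  assumes "closed_interval f I"
  shows "finite I" "x \<in> I \<Longrightarrow> z \<in> I \<Longrightarrow> x \<le> y \<Longrightarrow> y \<le> z \<Longrightarrow> y \<in> I"
    "x \<in> I \<Longrightarrow> f x \<in> I" "f x \<in> I \<Longrightarrow> x \<in> I"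
proof -
  have *: "finite I" "\<forall>x\<in>I. \<forall>z\<in>I. \<forall>y. x \<le> y \<and> y \<le> z \<longrightarrow> y \<in> I"
    "\<forall>x\<in>I. f x \<in> I" "\<forall>x\<in>I. f -` {x} \<subseteq> I"
    using assms unfolding closed_interval_def by blast+
  show "finite I" by (rule *(1))
  show "x \<in> I \<Longrightarrow> z \<in> I \<Longrightarrow> x \<le> y \<Longrightarrow> y \<le> z \<Longrightarrow> y \<in> I" using *(2) by blast
  show "x \<in> I \<Longrightarrow> f x \<in> I" using *(3) by blast
  show "x \<in> I" if "f x \<in> I"
  proof -
    have "f -` {f x} \<subseteq> I" using *(4) that by (rule bspec)
    then show ?thesis by auto
  qed
qed

text \<open>
  Blocks may be nested, but two blocks never overlap properly; hence the least element of a maximal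
  block is a boundary.
\<close>

lemma boundary_near:
  assumes bf: "block_function f" and M: "\<And>a. card (block f a) \<le> M"
  shows "\<exists>b. boundary f b \<and> b \<le> a \<and> a < b + M"
proof -
  note least = block_least[OF bf]
  \<comment> \<open>The sizes of the blocks containing \<open>a\<close> are bounded by
    \<open>M\<close>, so one of greatest size exists; its minimum will be the boundary.\<close>
  define P where "P n \<longleftrightarrow> (\<exists>c. a \<in> block f c \<and> card (block f c) = n)" for n
  have P: "P (card (block f a))" using least(1) unfolding P_def by blast
  have bound: "\<forall>n. P n \<longrightarrow> n \<le> M" using M unfolding P_def by blast
  obtain c where c: "a \<in> block f c" "card (block f c) = Greatest P"
    using GreatestI_nat[of P "card (block f a)" M] P bound unfolding P_def by blast
  have max: "card (block f d) \<le> card (block f c)" if "a \<in> block f d" for d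
    using Greatest_le_nat[of P "card (block f d)" M] bound that c(2) unfolding P_def by auto
  define I where "I = block f c"
  note I = closed_intervalD[OF least(2)[of c], folded I_def]
  have aI: "a \<in> I" and cI: "c \<in> I" using c(1) least(1) I_def by simp_all
  define b where "b = Min I"
  have bI: "b \<in> I" and bmin: "\<And>x. x \<in> I \<Longrightarrow> b \<le> x"
    unfolding b_def using I(1) aI by (auto intro: Min_in)
  \<comment> \<open>An edge over \<open>b\<close> has both ends in some block \<open>K\<close>,
    which then contains \<open>b\<close>. If \<open>K\<close> contains the generator
    \<open>c\<close>, it properly includes \<open>I\<close>, against maximality; otherwise removing
    \<open>K\<close> from \<open>I\<close> leaves a closed interval around \<open>c\<close> smaller
    than its block.\<close>
  have nocross: False if "x \<in> block f d" "y \<in> block f d" "x < b" "b \<le> y" for x y d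
  proof -
    define K where "K = block f d"
    note K = closed_intervalD[OF least(2)[of d], folded K_def]
    have xy: "x \<in> K" "y \<in> K" using that K_def by auto
    have bK: "b \<in> K" using K(2)[OF xy] that by simp
    show False
    proof (cases "c \<in> K")
      case True
      then have "I \<subseteq> K" unfolding I_def K_def by (intro least(3) least(2))
      moreover have "x \<notin> I" using bmin that(3) by force
      ultimately have "I \<subset> K" using xy by blast
      then have "card I < card K" using K(1) by (rule psubset_card_mono[rotated])
      moreover have "a \<in> K" using aI \<open>I \<subseteq> K\<close> by blast
      ultimately show False using max[of d] K_def I_def by simp
    next
      case False
      \<comment> \<open>\<open>b\<close> is the minimum of \<open>I\<close> and lies in
        \<open>K\<close>, so \<open>K\<close> meets \<open>I\<close> in an initial segment, and what
        remains is an interval.\<close>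
      have "y \<in> I - K" if "u \<in> I - K" "v \<in> I - K" "u \<le> y" "y \<le> v" for u v y
      proof -
        have "y \<in> I" using that I(2)[of u v y] by blast
        moreover have "y \<notin> K" using that K(2)[of b y u] bK bmin[of u] by blast
        ultimately show ?thesis by blast
      qed
      moreover have "f u \<in> I - K \<longleftrightarrow> u \<in> I - K" for u
        using I(3,4)[of u] K(3,4)[of u] by blast
      ultimately have "closed_interval f (I - K)"
        unfolding closed_interval_def using I(1) by blast
      then have "I \<subseteq> I - K" unfolding I_def using False cI
        by (intro least(3)) (simp_all add: I_def)
      then show False using bI bK by blast
    qed
  qed
  have "f x \<in> block f x" "x \<in> block f x" for x
    using least(1)[of x] closed_intervalD(3)[OF least(2)[of x], of x] by simp_all
  then have "boundary f b"
    unfolding boundary_def using nocross by (metis not_le)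
  moreover have "a < b + M"
  proof -
    have "{b..a} \<subseteq> I" using I(2)[OF bI aI] by auto
    then have "card {b..a} \<le> card I" using I(1) card_mono by blast
    then show ?thesis using M[of c] bmin[OF aI] unfolding I_def by simp
  qed
  ultimately show ?thesis using bmin[OF aI] by blast
qed

definition next_boundary :: "(nat \<Rightarrow> nat) \<Rightarrow> nat \<Rightarrow> nat" where
  "next_boundary f p = (LEAST q. p < q \<and> boundary f q)"

text \<open>This compares the relative values \<open>f (p + x) - p\<close> and
  \<open>f (a + x) - a\<close>; the sums avoid truncated subtraction.\<close>

definition same_pattern :: "(nat \<Rightarrow> nat) \<Rightarrow> nat \<Rightarrow> nat \<Rightarrow> nat \<Rightarrow> bool" where
  "same_pattern f a p m \<longleftrightarrow> (\<forall>x<m. f (p + x) + a = f (a + x) + p)"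

text \<open>Only the right end is asked to be a boundary: in the construction the left end is one
  because the preceding item fits.\<close>

definition occurs_at :: "(nat \<Rightarrow> nat) \<Rightarrow> nat \<Rightarrow> nat \<Rightarrow> nat \<Rightarrow> bool" where
  "occurs_at f a m p \<longleftrightarrow> boundary f (p + m) \<and> same_pattern f a p m"

definition recurrent_pattern :: "(nat \<Rightarrow> nat) \<Rightarrow> nat \<Rightarrow> nat \<Rightarrow> bool" where
  "recurrent_pattern f a m \<longleftrightarrow> infinite {p. boundary f p \<and> occurs_at f a m p}"

lemma boundary_0: "boundary f 0"
  by (simp add: boundary_def)

lemma boundary_less: "boundary f q \<Longrightarrow> f x < q \<longleftrightarrow> x < q"
  by (simp add: boundary_def)

lemma boundary_le: "boundary f q \<Longrightarrow> q \<le> f x \<longleftrightarrow> q \<le> x"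
  by (simp add: boundary_def flip: not_less)

text \<open>Both ends of the window at \<open>b\<close> are boundaries, so an edge crossing
  \<open>b + d\<close> lies inside the window, where edges are translates of edges in the window at
  \<open>a\<close>.\<close>

lemma same_pattern_boundary:
  assumes "boundary f a" "boundary f (a + m)" "boundary f b" "boundary f (b + m)"
    "same_pattern f a b m" "d \<le> m" "boundary f (a + d)"
  shows "boundary f (b + d)"
  unfolding boundary_def
proof
  fix x
  consider "x < b" | y where "x = b + y" "y < m" | "b + m \<le> x"
    by (metis le_add_diff_inverse linorder_not_le nat_add_left_cancel_less)
  then show "f x < b + d \<longleftrightarrow> x < b + d"
  proof cases
    case 1
    then show ?thesis using boundary_less[OF assms(3), of x] by simp
  next
    case 3
    then show ?thesis using boundary_le[OF assms(4), of x] assms(6) by simp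
  next
    case 2
    have "f (b + y) + a = f (a + y) + b" using assms(5) 2 by (simp add: same_pattern_def)
    moreover have "f (a + y) < a + d \<longleftrightarrow> y < d" using boundary_less[OF assms(7), of "a + y"] by simp
    ultimately show ?thesis using 2 by auto
  qed
qed

locale bounded_gaps =
  fixes f :: "nat \<Rightarrow> nat" and M :: nat
  assumes gap: "\<exists>b. boundary f b \<and> b \<le> a \<and> a < b + M"
begin

lemma ex_next: "\<exists>q. p < q \<and> q \<le> p + M \<and> boundary f q"
  using gap[of "p + M"] by auto

lemma next_boundary:
  "p < next_boundary f p" "boundary f (next_boundary f p)" "next_boundary f p \<le> p + M"
  "p < q \<Longrightarrow> boundary f q \<Longrightarrow> next_boundary f p \<le> q"
proof -
  obtain q where q: "p < q" "q \<le> p + M" "boundary f q" using ex_next by blast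
  have "p < next_boundary f p \<and> boundary f (next_boundary f p)"
    unfolding next_boundary_def by (rule LeastI[of _ q]) (simp add: q)
  then show "p < next_boundary f p" "boundary f (next_boundary f p)" by auto
  show *: "p < q \<Longrightarrow> boundary f q \<Longrightarrow> next_boundary f p \<le> q" for q
    unfolding next_boundary_def by (rule Least_le) simp
  show "next_boundary f p \<le> p + M" using *[OF q(1,3)] q(2) by simp
qed

lemma displacement: "f x < x + M" "x < f x + M"
proof -
  obtain q where q: "x < q" "q \<le> x + M" "boundary f q" using ex_next by blast
  show "f x < x + M" using boundary_less[OF q(3), of x] q by simp
  obtain b where b: "boundary f b" "b \<le> x" "x < b + M" using gap by blast
  show "x < f x + M" using boundary_le[OF b(1), of x] b by simp
qed

text \<open>\<open>f\<close> moves points by less than \<open>M\<close>, so no point from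
  \<open>q + M\<close> on can be sent below \<open>q\<close>. The bounded form makes
  \<open>boundary\<close> decidable.\<close>

lemma boundary_bounded: "boundary f q \<longleftrightarrow> (\<forall>x<q + M. f x < q \<longleftrightarrow> x < q)"
proof
  assume *: "\<forall>x<q + M. f x < q \<longleftrightarrow> x < q"
  show "boundary f q" unfolding boundary_def
  proof
    fix x show "f x < q \<longleftrightarrow> x < q"
      using * displacement(2)[of x] by (cases "x < q + M") auto
  qed
qed (simp add: boundary_def)

section \<open>The sequence of letters between consecutive boundaries\<close>

primrec bd :: "nat \<Rightarrow> nat" where
  "bd 0 = 0"
| "bd (Suc i) = next_boundary f (bd i)"

lemma boundary_bd: "boundary f (bd i)"
  by (cases i) (simp_all add: boundary_0 next_boundary)

lemma strict_mono_bd: "strict_mono bd"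
  by (simp add: strict_mono_Suc_iff next_boundary)

lemma ex_bd: assumes "boundary f q" shows "\<exists>i. q = bd i"
proof -
  have "\<exists>i. q \<le> bd i" using strict_mono_imp_increasing[OF strict_mono_bd] by blast
  then obtain i where "q \<le> bd i" by blast
  then show ?thesis
  proof (induction i)
    case (Suc i)
    show ?case
    proof (cases "q \<le> bd i")
      case False
      then have "q = bd (Suc i)" using next_boundary(4)[of "bd i" q] assms Suc.prems by simp
      then show ?thesis by blast
    qed (rule Suc.IH)
  qed (metis bd.simps(1) le_zero_eq)
qed

text \<open>Values are relative to the left end, so equal letters are translates of each other.
  Nothing is truncated: since \<open>bd i\<close> is a boundary, values at points from
  \<open>bd i\<close> on are not below it.\<close>

definition letter :: "nat \<Rightarrow> nat list" where
  "letter i = map (\<lambda>x. f (bd i + x) - bd i) [0..<bd (Suc i) - bd i]"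

lemma bd_Suc: "bd (Suc i) = bd i + length (letter i)"
  using strict_monoD[OF strict_mono_bd, of i "Suc i"] by (simp add: letter_def)

declare bd.simps(2) [simp del]

lemma bd_next: "next_boundary f (bd i) = bd i + length (letter i)"
  by (simp add: bd_Suc flip: bd.simps(2))

lemma letter_nonempty: "length (letter i) > 0"
  using strict_monoD[OF strict_mono_bd, of i "Suc i"] by (simp add: letter_def)

lemma finite_letters: "finite (range letter)"
proof -
  have "set (letter i) \<subseteq> {..M} \<and> length (letter i) \<le> M" for i
  proof -
    have "bd (Suc i) \<le> bd i + M" using next_boundary(3) by (simp add: bd.simps)
    moreover have "f (bd i + x) < bd (Suc i)" if "x < bd (Suc i) - bd i" for x
      using boundary_less[OF boundary_bd, of "bd i + x" "Suc i"] that by simp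
    ultimately show ?thesis unfolding letter_def by fastforce
  qed
  then have "range letter \<subseteq> {xs. set xs \<subseteq> {..M} \<and> length xs \<le> M}" by auto
  then show ?thesis using finite_lists_length_le[of "{..M}" M] finite_subset by blast
qed

lemma bd_add: "bd (i + l) = bd i + (\<Sum>u<l. length (letter (i + u)))"
  by (induction l) (simp_all add: bd_Suc)

lemma same_pattern_letters:
  assumes "\<forall>u<l. letter (i + u) = letter (j + u)"
  shows "same_pattern f (bd i) (bd j) (bd (i + l) - bd i)"
  using assms
proof (induction l)
  case (Suc l)
  have len: "bd (i + l) + bd j = bd (j + l) + bd i" using Suc.prems by (simp add: bd_add)
  have le: "bd i \<le> bd (i + l)" "bd j \<le> bd (j + l)" by (simp_all add: bd_add)
  show ?case unfolding same_pattern_def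
  proof (intro allI impI)
    fix x assume x: "x < bd (i + Suc l) - bd i"
    show "f (bd j + x) + bd i = f (bd i + x) + bd j"
    proof (cases "x < bd (i + l) - bd i")
      case True
      then show ?thesis using Suc by (simp add: same_pattern_def)
    next
      case False
      define y where "y = x - (bd (i + l) - bd i)"
      have xy: "bd i + x = bd (i + l) + y" "bd j + x = bd (j + l) + y"
        using False len le by (simp_all add: y_def)
      have y: "y < length (letter (i + l))" using x False le by (simp add: y_def bd_Suc)
      have "letter (i + l) = letter (j + l)" using Suc.prems by simp
      then have "letter (i + l) ! y = letter (j + l) ! y" "y < length (letter (j + l))"
        using y by simp_all
      then have "f (bd (i + l) + y) - bd (i + l) = f (bd (j + l) + y) - bd (j + l)"
        using y by (simp add: letter_def)
      moreover have "bd (i + l) \<le> f (bd (i + l) + y)" "bd (j + l) \<le> f (bd (j + l) + y)"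
        using boundary_le[OF boundary_bd] by simp_all
      ultimately show ?thesis using len xy by simp
    qed
  qed
qed (simp add: same_pattern_def)

text \<open>By induction the letters before \<open>t\<close> agree, so both letters at
  \<open>t\<close> start at the same offset; \<open>same_pattern_boundary\<close>, used in both
  directions, shows that they end at the same offset. The numbers \<open>l\<close> and
  \<open>l'\<close> of letters may differ.\<close>

lemma letters_of_same_pattern:
  assumes same: "same_pattern f (bd i) (bd j) m"
    and m: "bd i + m = bd (i + l)" "bd j + m = bd (j + l')"
  shows "t < l \<Longrightarrow> t < l' \<Longrightarrow> letter (i + t) = letter (j + t)"
proof (induction t rule: less_induct)
  case (less t)
  have same': "same_pattern f (bd j) (bd i) m" using same by (simp add: same_pattern_def)
  define d where "d = (\<Sum>u<t. length (letter (i + u)))"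
  have "d = (\<Sum>u<t. length (letter (j + u)))"
    unfolding d_def using less by (intro sum.cong) simp_all
  then have d: "bd (i + t) = bd i + d" "bd (j + t) = bd j + d"
    by (simp_all only: bd_add d_def)
  let ?e = "length (letter (i + t))" and ?e' = "length (letter (j + t))"
  have le: "d + ?e \<le> m" "d + ?e' \<le> m"
  proof -
    have "bd (Suc (i + t)) \<le> bd (i + l)" "bd (Suc (j + t)) \<le> bd (j + l')"
      using less.prems strict_mono_less_eq[OF strict_mono_bd] by simp_all
    then show "d + ?e \<le> m" "d + ?e' \<le> m" using m d by (simp_all add: bd_Suc)
  qed
  have bdm: "boundary f (bd i + m)" "boundary f (bd j + m)" using m boundary_bd by simp_all
  have "boundary f (bd j + (d + ?e))"
    using same_pattern_boundary[OF boundary_bd bdm(1) boundary_bd bdm(2) same le(1)]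
      boundary_bd[of "Suc (i + t)"] d by (simp add: bd_Suc add.assoc)
  then have 1: "?e' \<le> ?e"
    using next_boundary(4)[of "bd (j + t)" "bd j + (d + ?e)"] bd_next[of "j + t"] d letter_nonempty[of "i + t"]
    by simp
  have "boundary f (bd i + (d + ?e'))"
    using same_pattern_boundary[OF boundary_bd bdm(2) boundary_bd bdm(1) same' le(2)]
      boundary_bd[of "Suc (j + t)"] d by (simp add: bd_Suc add.assoc)
  then have 2: "?e \<le> ?e'"
    using next_boundary(4)[of "bd (i + t)" "bd i + (d + ?e')"] bd_next[of "i + t"] d letter_nonempty[of "j + t"]
    by simp
  show ?case
  proof (rule nth_equalityI)
    show "?e = ?e'" using 1 2 by simp
    fix x assume x: "x < ?e"
    have "f (bd j + (d + x)) + bd i = f (bd i + (d + x)) + bd j"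
      using same x le unfolding same_pattern_def by simp
    then show "letter (i + t) ! x = letter (j + t) ! x"
      using x 1 2 d unfolding letter_def by (simp add: add.assoc) 
  qed
qed

lemma recurrent_pattern_word:
  assumes "recurrent_word letter i l"
  shows "recurrent_pattern f (bd i) (bd (i + l) - bd i)"
proof -
  let ?S = "{p. \<forall>t<l. letter (p + t) = letter (i + t)}"
  have "bd ` ?S \<subseteq> {p. boundary f p \<and> occurs_at f (bd i) (bd (i + l) - bd i) p}"
  proof safe
    fix p assume p: "\<forall>t<l. letter (p + t) = letter (i + t)"
    have "bd p + (bd (i + l) - bd i) = bd (p + l)" using p by (simp add: bd_add)
    then show "occurs_at f (bd i) (bd (i + l) - bd i) (bd p)"
      unfolding occurs_at_def using same_pattern_letters[of l i p] p boundary_bd[of "p + l"] by simp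
  qed (rule boundary_bd)
  moreover have "infinite (bd ` ?S)"
    using assms unfolding recurrent_word_def
    by (subst finite_image_iff) (auto intro: inj_on_subset[OF strict_mono_imp_inj_on[OF strict_mono_bd]])
  ultimately show ?thesis unfolding recurrent_pattern_def using finite_subset by blast
qed

lemma eventually_recurrent_blocks:
  "\<exists>i0>0. boundary f i0 \<and> (\<forall>p\<ge>i0. boundary f p \<longrightarrow> recurrent_pattern f p (next_boundary f p - p))"
proof -
  obtain i0 where i0: "\<And>i. i \<ge> i0 \<Longrightarrow> recurrent_word letter i 1"
    using eventually_recurrent_word[OF finite_letters] by blast
  show ?thesis
  proof (intro exI conjI allI impI)
    show "boundary f (bd (Suc i0))" by (rule boundary_bd)
    show "0 < bd (Suc i0)" using strict_monoD[OF strict_mono_bd, of 0 "Suc i0"] by simp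
    fix p assume "bd (Suc i0) \<le> p" "boundary f p"
    then obtain i where i: "p = bd i" using ex_bd by blast
    then have "i \<ge> i0" using \<open>bd (Suc i0) \<le> p\<close> strict_mono_less_eq[OF strict_mono_bd, of "Suc i0" i] by simp
    from recurrent_pattern_word[OF i0[OF this]]
    show "recurrent_pattern f p (next_boundary f p - p)" using i by (simp add: bd.simps)
  qed
qed

lemma two_patterns_or_periodic:
  assumes "\<not> almost_identity f"
  obtains (two) a b m x where "boundary f a" "boundary f b" "recurrent_pattern f a m"
      "recurrent_pattern f b m" "x < m" "f (a + x) + b \<noteq> f (b + x) + a" "boundary f (a + m)"
  | (periodic) a k where "k > 0" "boundary f a" "\<And>x. x \<ge> a \<Longrightarrow> f (x + k) = f x + k" "\<And>t. boundary f (a + t * k)"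
proof (cases "\<exists>i0. \<forall>i\<ge>i0. letter i = letter i0")
  case False
  from word_dichotomy[of letter length, OF finite_letters letter_nonempty False]
  obtain i j l l' t where w: "t < l" "t < l'" "letter (i + t) \<noteq> letter (j + t)"
    "(\<Sum>u<l. length (letter (i + u))) = (\<Sum>u<l'. length (letter (j + u)))"
    "recurrent_word letter i l" "recurrent_word letter j l'" by blast
  define m where "m = (\<Sum>u<l. length (letter (i + u)))"
  have m: "bd (i + l) = bd i + m" "bd (j + l') = bd j + m" using w(4) by (simp_all add: bd_add m_def)
  \<comment> \<open>A common pattern would force equal letters at \<open>t\<close>. So some relative
    position \<open>x\<close> tells the two windows apart; it will carry the coded bit.\<close>
  have "\<not> same_pattern f (bd i) (bd j) m"
    using letters_of_same_pattern[of i j m l l' t] m w by auto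
  then obtain x where x: "x < m" "f (bd j + x) + bd i \<noteq> f (bd i + x) + bd j"
    unfolding same_pattern_def by blast
  show thesis
  proof (rule two)
    show "recurrent_pattern f (bd i) m" "recurrent_pattern f (bd j) m"
      using recurrent_pattern_word[OF w(5)] recurrent_pattern_word[OF w(6)] m by simp_all
    show "boundary f (bd i + m)" using boundary_bd[of "i + l"] m by simp
    show "f (bd i + x) + bd j \<noteq> f (bd j + x) + bd i" using x(2) by simp
  qed (use x boundary_bd in auto)
next
  case True
  then obtain i0 where i0: "\<And>i. i \<ge> i0 \<Longrightarrow> letter i = letter i0" by blast
  define k where "k = length (letter i0)"
  have "length (letter (i0 + t)) = k" for t using i0[of "i0 + t"] by (simp add: k_def)
  then have step: "bd (i0 + t) = bd i0 + t * k" for t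
    by (induction t) (simp_all add: bd_Suc)
  show thesis
  proof (rule periodic)
    show "k > 0" unfolding k_def by (rule letter_nonempty)
    show "boundary f (bd i0)" by (rule boundary_bd)
    show "boundary f (bd i0 + t * k)" for t using boundary_bd[of "i0 + t"] step by simp
    fix x assume "x \<ge> bd i0"
    then obtain y where y: "x = bd i0 + y" using le_Suc_ex by blast
    have "same_pattern f (bd i0) (bd (Suc i0)) (bd (i0 + Suc y) - bd i0)"
      by (rule same_pattern_letters) (metis add_Suc i0 le_add1 le_SucI)
    moreover have "y < bd (i0 + Suc y) - bd i0" 
      using \<open>k > 0\<close> by (subst step) (cases k; simp)
    ultimately have "f (bd (Suc i0) + y) + bd i0 = f (bd i0 + y) + bd (Suc i0)"
      by (simp add: same_pattern_def)
    then show "f (x + k) = f x + k" using y by (simp add: bd_Suc k_def ac_simps)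
  qed
qed

end

section \<open>The construction of the copy\<close>

text \<open>
  An item is a contiguous run of elements of the copy.  Tag \<open>0\<close> marks a filler whose pattern is that
  of the block starting at \<open>age\<close>; tag \<open>Suc n\<close> marks the area coding \<open>n\<close>, which has changed its
  status \<open>age\<close> times.
\<close>

datatype item = Item (tag: nat) (age: nat) (elems: "nat list")

definition flat :: "item list \<Rightarrow> nat list" where
  "flat zs = concat (map elems zs)"

lemma flat_simps [simp]:
  "flat [] = []" "flat (z # zs) = elems z @ flat zs" "flat (xs @ ys) = flat xs @ flat ys"
  by (simp_all add: flat_def)

text \<open>Together with \<open>nth_of_subseq_pair\<close> this transfers the order of two elements
  at one stage to all later stages, each stage being a subsequence of the next.\<close>

lemma subseq_pair_nth: "i < j \<Longrightarrow> j < length xs \<Longrightarrow> subseq [xs ! i, xs ! j] xs"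
proof (induction xs arbitrary: i j)
  case (Cons a xs)
  then obtain j' where j: "j = Suc j'" by (cases j) auto
  show ?case
  proof (cases i)
    case 0
    then show ?thesis using Cons.prems j by (simp add: subseq_singleton_left)
  next
    case (Suc i')
    then show ?thesis using Cons j by (auto intro: subseq_Cons')
  qed
qed simp

lemma nth_of_subseq_pair: "subseq [x, y] xs \<Longrightarrow> \<exists>i j. i < j \<and> j < length xs \<and> xs ! i = x \<and> xs ! j = y"
proof (induction xs)
  case (Cons a xs)
  show ?case
  proof (cases "subseq [x, y] xs")
    case True
    then obtain i j where "i < j" "j < length xs" "xs ! i = x" "xs ! j = y" using Cons.IH by blast
    then show ?thesis by (intro exI[of _ "Suc i"] exI[of _ "Suc j"]) simp
  next
    case False
    then have "x = a" "y \<in> set xs"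
      using Cons.prems by (auto simp: subseq_singleton_left split: if_splits)
    then obtain j where "j < length xs" "xs ! j = y" by (meson in_set_conv_nth)
    then show ?thesis using \<open>x = a\<close> by (intro exI[of _ 0] exI[of _ "Suc j"]) simp
  qed
qed simp

text \<open>An occurrence with boundaries at both ends is closed under \<open>f\<close>, and
  translation carries the closure back to \<open>a\<close>.\<close>

lemma recurrent_pattern_closed:
  assumes "recurrent_pattern f a m" "x < m"
  shows "a \<le> f (a + x)" "f (a + x) < a + m"
proof -
  obtain p where p: "boundary f p" "occurs_at f a m p"
    using assms(1) unfolding recurrent_pattern_def by (metis (no_types, lifting) Collect_empty_eq finite.emptyI)
  then have "f (p + x) + a = f (a + x) + p" "p \<le> f (p + x)" "f (p + x) < p + m"
    using assms(2) boundary_le[of f p "p + x"] boundary_less[of f "p + m" "p + x"]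
    by (auto simp: occurs_at_def same_pattern_def)
  then show "a \<le> f (a + x)" "f (a + x) < a + m" by simp_all
qed

text \<open>
  An area of age \<open>j\<close> carries the pattern of \<open>f\<close> on \<open>[loc j, loc j + len j)\<close>, and \<open>off j\<close> is the number
  of elements added at its left end since it was created; \<open>(cx, cy)\<close> are the initial
  indices of the pair of elements from which the coded bit is read off.
\<close>

locale coding_scheme = bounded_gaps f M for f M +
  fixes i0 cx cy :: nat and loc len off :: "nat \<Rightarrow> nat"
  assumes boundary_i0: "boundary f i0"
    and recurrent_blocks: "p \<ge> i0 \<Longrightarrow> boundary f p \<Longrightarrow> recurrent_pattern f p (next_boundary f p - p)"
    and recurrent_area: "recurrent_pattern f (loc j) (len j)"
    and off_Suc: "off j \<le> off (Suc j)"
    and len_Suc: "len j + off (Suc j) \<le> len (Suc j) + off j"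
    and coherent: "j \<le> j' \<Longrightarrow> even j \<longleftrightarrow> even j' \<Longrightarrow> x < len j \<Longrightarrow>
      f (loc j' + (x + (off j' - off j))) + loc j = f (loc j + x) + loc j' + (off j' - off j)"
    and coding: "f (loc j + (cx + off j)) = loc j + (cy + off j) \<longleftrightarrow> even j"
    and coding_inside: "cx + off j < len j" "cy + off j < len j"
begin

definition item_loc :: "item \<Rightarrow> nat" where
  "item_loc z = (if tag z = 0 then age z else loc (age z))"

definition filler :: "nat \<Rightarrow> nat \<Rightarrow> item" where
  "filler p N = Item 0 p ([N..<N + (next_boundary f p - p)])"

definition grow :: "nat \<Rightarrow> item \<Rightarrow> item" where
  "grow N z = Item (tag z) (Suc (age z))
     ([N..<N + (off (Suc (age z)) - off (age z))] @ elems z @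
     [N + (off (Suc (age z)) - off (age z))..<N + (len (Suc (age z)) - len (age z))])"

definition fits :: "nat \<Rightarrow> item \<Rightarrow> bool" where
  "fits p z \<longleftrightarrow> occurs_at f (item_loc z) (length (elems z)) p"

definition valid :: "item \<Rightarrow> bool" where
  "valid z \<longleftrightarrow> (if tag z = 0 then recurrent_pattern f (age z) (length (elems z))
     else length (elems z) = len (age z))"

lemma valid_recurrent: "valid z \<Longrightarrow> recurrent_pattern f (item_loc z) (length (elems z))"
  by (auto simp: valid_def item_loc_def recurrent_area split: if_splits)

lemma off_mono: "j \<le> j' \<Longrightarrow> off j \<le> off j'"
  using off_Suc by (rule lift_Suc_mono_le)

lemma len_grow: "off (Suc j) - off j \<le> len (Suc j) - len j" "len j \<le> len (Suc j)"
  using len_Suc[of j] off_Suc[of j] by simp_all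

lemma valid_closed:
  "valid z \<Longrightarrow> x < length (elems z) \<Longrightarrow> item_loc z \<le> f (item_loc z + x)"
  "valid z \<Longrightarrow> x < length (elems z) \<Longrightarrow> f (item_loc z + x) < item_loc z + length (elems z)"
  using recurrent_pattern_closed valid_recurrent by blast+

lemma fits_filler: "fits p (filler p N)"
  using next_boundary[of p]
  by (simp add: fits_def occurs_at_def item_loc_def filler_def same_pattern_def)

lemma valid_filler: "p \<ge> i0 \<Longrightarrow> boundary f p \<Longrightarrow> valid (filler p N)"
  using recurrent_blocks by (simp add: valid_def filler_def)

lemma valid_grow: "valid z \<Longrightarrow> tag z \<noteq> 0 \<Longrightarrow> valid (grow N z)"
  using len_grow[of "age z"] by (simp add: valid_def grow_def)

text \<open>A later form of the same item: fillers never change, areas take in elements at both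
  ends. The length of \<open>l\<close> depends only on the two ages, so an index \<open>x\<close>
  becomes \<open>x + (off (age z') - off (age z))\<close>.\<close>

definition descendant :: "item \<Rightarrow> item \<Rightarrow> bool" where
  "descendant z z' \<longleftrightarrow> z = z' \<or> tag z \<noteq> 0 \<and> tag z = tag z' \<and> age z \<le> age z' \<and>
     (\<exists>l r. elems z' = l @ elems z @ r \<and> length l = off (age z') - off (age z))"

lemma descendant_refl: "descendant z z"
  by (simp add: descendant_def)

lemma descendant_trans:
  assumes "descendant z z'" "descendant z' z''" shows "descendant z z''"
proof (cases "z = z' \<or> z' = z''")
  case False
  with assms obtain l r l' r' where
    1: "elems z' = l @ elems z @ r" "length l = off (age z') - off (age z)" "age z \<le> age z'" and
    2: "elems z'' = l' @ elems z' @ r'" "length l' = off (age z'') - off (age z')" "age z' \<le> age z''"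
    unfolding descendant_def by blast
  have "elems z'' = (l' @ l) @ elems z @ (r @ r')" using 1 2 by simp
  moreover have "length (l' @ l) = off (age z'') - off (age z)"
    using 1 2 off_mono[OF 1(3)] off_mono[OF 2(3)] by simp
  ultimately show ?thesis using assms False 1 2 unfolding descendant_def by (metis order_trans)
qed (use assms in auto)

lemma descendant_grow: "tag z \<noteq> 0 \<Longrightarrow> descendant z (grow N z)"
  unfolding descendant_def grow_def by auto

lemma descendant_elems: "descendant z z' \<Longrightarrow> set (elems z) \<subseteq> set (elems z')"
  unfolding descendant_def by auto

end

section \<open>The stages of the construction\<close>

locale coding_construction = coding_scheme +
  fixes As :: "nat \<Rightarrow> nat \<Rightarrow> bool" and A :: "nat set"
  assumes limit: "\<exists>s0. \<forall>s\<ge>s0. As n s \<longleftrightarrow> n \<in> A"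
begin

text \<open>The parity of the age is the guess on display; an area is created with age 0 and so
  displays non-membership.\<close>

definition status_ok :: "nat \<Rightarrow> item \<Rightarrow> bool" where
  "status_ok s z \<longleftrightarrow> (tag z \<noteq> 0 \<longrightarrow> (odd (age z) \<longleftrightarrow> As (tag z - 1) s))"

text \<open>Only the leftmost defect is repaired in one call, since an insertion displaces
  everything after it. A misfit comes before a wrong status, so an area grows only where it fits.
  The filler copies the block of \<open>f\<close> starting at \<open>p\<close> and fits at once; the
  recursion keeps \<open>p\<close> at a boundary.\<close>

fun act :: "nat \<Rightarrow> nat \<Rightarrow> nat \<Rightarrow> item list \<Rightarrow> item list" where
  "act s N p [] = []"
| "act s N p (z # zs) =
    (if \<not> fits p z then filler p N # z # zs
     else if \<not> status_ok s z then grow N z # zs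
     else z # act s N (p + length (elems z)) zs)"

text \<open>Two roles: the position in the copy at which the item after \<open>zs\<close> starts
  and, when \<open>zs\<close> is a whole stage, the least number not yet used (see
  \<open>all_fresh\<close>).\<close>

definition fresh :: "item list \<Rightarrow> nat" where
  "fresh zs = i0 + length (flat zs)"

definition new_area :: "nat \<Rightarrow> item list \<Rightarrow> item" where
  "new_area s zs = Item (Suc s) 0 ([fresh zs..<fresh zs + len 0])"

primrec B :: "nat \<Rightarrow> item list" where
  "B 0 = []"
| "B (Suc s) = (let K = act s (fresh (B s)) i0 (B s) in K @ [new_area s K])"

lemma act_disj:
  "boundary f p \<Longrightarrow> act s N p zs = zs \<or>
    (\<exists>us z vs. zs = us @ z # vs \<and> boundary f (p + length (flat us)) \<and>
      act s N p zs = us @ filler (p + length (flat us)) N # z # vs) \<or>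
    (\<exists>us z vs. zs = us @ z # vs \<and> tag z \<noteq> 0 \<and> act s N p zs = us @ grow N z # vs)"
proof (induction zs arbitrary: p)
  case (Cons z zs)
  consider "\<not> fits p z" | "fits p z" "\<not> status_ok s z" | "fits p z" "status_ok s z" by blast
  then show ?case
  proof cases
    case 1
    then show ?thesis using Cons.prems by (intro disjI2 disjI1 exI[of _ "[]"] exI[of _ z] exI[of _ zs]) simp
  next
    case 2
    then have "tag z \<noteq> 0" by (auto simp: status_ok_def)
    then show ?thesis using 2 by (intro disjI2 exI[of _ "[]"] exI[of _ z] exI[of _ zs]) simp
  next
    case 3
    then have "boundary f (p + length (elems z))" by (simp add: fits_def occurs_at_def)
    from Cons.IH[OF this] show ?thesis
    proof (elim disjE exE conjE)
      assume "act s N (p + length (elems z)) zs = zs"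
      then show ?thesis using 3 by simp
    next
      fix us y vs
      assume "zs = us @ y # vs" "boundary f (p + length (elems z) + length (flat us))"
        "act s N (p + length (elems z)) zs = us @ filler (p + length (elems z) + length (flat us)) N # y # vs"
      then show ?thesis using 3
        by (intro disjI2 disjI1 exI[of _ "z # us"] exI[of _ y] exI[of _ vs]) (simp add: add.assoc)
    next
      fix us y vs
      assume "zs = us @ y # vs" "tag y \<noteq> 0" "act s N (p + length (elems z)) zs = us @ grow N y # vs"
      then show ?thesis using 3
        by (intro disjI2 exI[of _ "z # us"] exI[of _ y] exI[of _ vs]) simp
    qed
  qed
qed simp

lemma act_cases:
  obtains (unchanged) "act s N i0 zs = zs"
  | (fill) us z vs where "zs = us @ z # vs" "boundary f (i0 + length (flat us))"
      "act s N i0 zs = us @ filler (i0 + length (flat us)) N # z # vs"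
  | (grow) us z vs where "zs = us @ z # vs" "tag z \<noteq> 0" "act s N i0 zs = us @ grow N z # vs"
  using act_disj[OF boundary_i0, of s N zs] by blast

definition all_fresh :: "item list \<Rightarrow> bool" where
  "all_fresh zs \<longleftrightarrow> distinct (flat zs) \<and> set (flat zs) = {i0..<fresh zs}"

lemma all_fresh_insert:
  assumes "all_fresh (us @ vs)" "elems z = [fresh (us @ vs)..<fresh (us @ vs) + n]"
  shows "all_fresh (us @ z # vs)"
proof -
  have old: "distinct (flat (us @ vs))" "set (flat (us @ vs)) = {i0..<fresh (us @ vs)}"
    using assms(1) unfolding all_fresh_def by blast+
  have "set (elems z) \<inter> set (flat (us @ vs)) = {}" unfolding old(2) assms(2) by auto
  then have dist: "distinct (flat (us @ z # vs))" using old(1) assms(2) by auto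
  have "set (flat (us @ z # vs)) = set (flat (us @ vs)) \<union> set (elems z)" by auto
  also have "\<dots> = {i0..<fresh (us @ z # vs)}"
    unfolding old(2) assms(2) using assms(2) by (auto simp: fresh_def)
  finally show ?thesis using dist unfolding all_fresh_def by blast
qed

lemma length_elems_grow:
  assumes "valid z" "tag z \<noteq> 0"
  shows "length (elems (grow N z)) = length (elems z) + (len (Suc (age z)) - len (age z))"
  using len_grow[of "age z"] by (simp add: grow_def)

lemma all_fresh_grow:
  assumes "all_fresh (us @ z # vs)" "valid z" "tag z \<noteq> 0"
  shows "all_fresh (us @ grow (fresh (us @ z # vs)) z # vs)"
proof -
  let ?N = "fresh (us @ z # vs)" and ?n = "len (Suc (age z)) - len (age z)"
  have old: "distinct (flat (us @ z # vs))" "set (flat (us @ z # vs)) = {i0..<?N}"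
    using assms(1) unfolding all_fresh_def by blast+
  have e: "set (elems (grow ?N z)) = set (elems z) \<union> {?N..<?N + ?n}"
    using len_grow[of "age z"] by (auto simp: grow_def)
  have "fresh (us @ grow ?N z # vs) = ?N + ?n"
    using length_elems_grow[OF assms(2,3)] by (simp add: fresh_def)
  moreover have "set (flat (us @ grow ?N z # vs)) = set (flat (us @ z # vs)) \<union> {?N..<?N + ?n}"
    using e by auto
  moreover have "\<dots> = {i0..<?N + ?n}" unfolding old(2) by (auto simp: fresh_def)
  moreover have "distinct (flat (us @ grow ?N z # vs))"
  proof -
    have "set (flat us) \<subseteq> {..<?N}" "set (elems z) \<subseteq> {..<?N}" "set (flat vs) \<subseteq> {..<?N}"
      using old(2) by auto
    then have "set (flat us) \<inter> {?N..} = {}" "set (elems z) \<inter> {?N..} = {}" "set (flat vs) \<inter> {?N..} = {}"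
      by auto
    moreover have "set (elems (grow ?N z)) \<subseteq> set (elems z) \<union> {?N..}" using e by auto
    moreover have "distinct (elems (grow ?N z))"
      using old(1) calculation(2) by (auto simp: grow_def)
    ultimately show ?thesis using old(1) by auto
  qed
  ultimately show ?thesis unfolding all_fresh_def by simp
qed

lemma act_inv:
  assumes "all_fresh zs" "\<forall>z\<in>set zs. valid z"
  shows "all_fresh (act s (fresh zs) i0 zs)" "\<forall>z\<in>set (act s (fresh zs) i0 zs). valid z"
    "subseq (flat zs) (flat (act s (fresh zs) i0 zs))"
proof -
  have "all_fresh (act s (fresh zs) i0 zs) \<and> (\<forall>z\<in>set (act s (fresh zs) i0 zs). valid z) \<and>
    subseq (flat zs) (flat (act s (fresh zs) i0 zs))"
  proof (cases rule: act_cases[of s "fresh zs" zs])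
    case unchanged
    then show ?thesis using assms by simp
  next
    case (fill us z vs)
    have "all_fresh (us @ filler (i0 + length (flat us)) (fresh zs) # z # vs)"
      using all_fresh_insert[of us "z # vs"] assms fill(1) by (simp add: filler_def)
    moreover have "subseq (flat us @ elems z @ flat vs) (flat us @ e @ elems z @ flat vs)" for e
      by (intro list_emb_append_mono subseq_drop_many) simp_all
    ultimately show ?thesis using fill assms valid_filler by auto
  next
    case (grow us z vs)
    have "subseq (flat us @ elems z @ flat vs) (flat us @ (l @ elems z @ r) @ flat vs)" for l r
      by (intro list_emb_append_mono subseq_drop_many subseq_rev_drop_many) simp_all
    then have "subseq (flat (us @ z # vs)) (flat (us @ local.grow N z # vs))" for N
      by (simp add: grow_def)
    then show ?thesis using all_fresh_grow[of us z vs] assms valid_grow[of z] grow by auto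
  qed
  then show "all_fresh (act s (fresh zs) i0 zs)" "\<forall>z\<in>set (act s (fresh zs) i0 zs). valid z"
    "subseq (flat zs) (flat (act s (fresh zs) i0 zs))" by blast+
qed

lemma B_inv: "all_fresh (B s)" "\<forall>z\<in>set (B s). valid z"
proof -
  have "all_fresh (B s) \<and> (\<forall>z\<in>set (B s). valid z)"
  proof (induction s)
    case (Suc s)
    let ?K = "act s (fresh (B s)) i0 (B s)"
    have K: "all_fresh ?K" "\<forall>z\<in>set ?K. valid z" using act_inv Suc by blast+
    have "all_fresh (?K @ new_area s ?K # [])"
      by (rule all_fresh_insert[of _ _ _ "len 0"]) (simp_all add: K new_area_def)
    moreover have "valid (new_area s ?K)" by (simp add: valid_def new_area_def)
    ultimately show ?case using K by (simp add: Let_def)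
  qed (simp add: all_fresh_def fresh_def)
  then show "all_fresh (B s)" "\<forall>z\<in>set (B s). valid z" by blast+
qed

text \<open>The first \<open>i0\<close> elements stand outside the items, since blocks below
  \<open>i0\<close> need not recur.\<close>

definition F :: "nat \<Rightarrow> nat list" where
  "F s = [0..<i0] @ flat (B s)"

lemma subseq_F: "s \<le> t \<Longrightarrow> subseq (F s) (F t)"
proof (induction t)
  case (Suc t)
  have "subseq (flat (B t)) (flat (B (Suc t)))"
    using act_inv(3)[OF B_inv, of t] by (simp add: Let_def subseq_rev_drop_many)
  then have "subseq (F t) (F (Suc t))" unfolding F_def by (intro list_emb_append_mono) simp_all
  then show ?case using Suc by (metis le_Suc_eq subseq_order.order_refl subseq_order.order_trans)
qed simp

lemma F_inv: "distinct (F s)" "set (F s) = {..<length (F s)}"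
proof -
  have old: "distinct (flat (B s))" "set (flat (B s)) = {i0..<fresh (B s)}"
    using B_inv(1) unfolding all_fresh_def by blast+
  have "length (F s) = fresh (B s)" by (simp add: F_def fresh_def)
  moreover have "set (F s) = {0..<i0} \<union> {i0..<fresh (B s)}" unfolding old(2)[symmetric] F_def by simp
  moreover have "{0..<i0} \<union> {i0..<fresh (B s)} = {..<fresh (B s)}" by (auto simp: fresh_def)
  ultimately show "set (F s) = {..<length (F s)}" by simp
  have "set [0..<i0] \<inter> set (flat (B s)) = {}" unfolding old(2) by auto
  then show "distinct (F s)" using old(1) by (simp add: F_def)
qed

lemma length_F_Suc: "length (F s) < length (F (Suc s))"
proof -
  have "length (flat (B s)) \<le> length (flat (act s (fresh (B s)) i0 (B s)))"
    using act_inv(3)[OF B_inv] by (rule list_emb_length)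
  moreover have "len 0 > 0" using coding_inside[of 0] by simp
  ultimately show ?thesis by (simp add: F_def Let_def new_area_def)
qed

lemma length_F: "s \<le> length (F s)"
proof (induction s)
  case (Suc s)
  then show ?case using length_F_Suc[of s] by simp
qed simp

section \<open>Every item settles after finitely many changes\<close>

definition settled :: "nat \<Rightarrow> item list \<Rightarrow> bool" where
  "settled s xs \<longleftrightarrow> prefix xs (B s) \<and>
     (\<forall>us z vs. xs = us @ z # vs \<longrightarrow> fits (fresh us) z \<and> (\<forall>t\<ge>s. status_ok t z))"

lemma settledD:
  assumes "settled s (us @ z # vs)"
  shows "fits (fresh us) z" "s \<le> t \<Longrightarrow> status_ok t z"
  using assms unfolding settled_def by blast+

lemma settled_prefix: assumes "settled s (xs @ ys)" shows "settled s xs"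
  unfolding settled_def
proof (intro conjI allI impI)
  show "prefix xs (B s)" using assms append_prefixD unfolding settled_def by blast
  fix us z vs assume "xs = us @ z # vs"
  then have "settled s (us @ z # (vs @ ys))" using assms by simp
  then show "fits (fresh us) z" "\<And>t. s \<le> t \<Longrightarrow> status_ok t z" using settledD by blast+
qed

lemma settled_snoc:
  assumes "settled s xs" "prefix (xs @ [z]) (B s)" "fits (fresh xs) z" "\<forall>t\<ge>s. status_ok t z"
  shows "settled s (xs @ [z])"
  unfolding settled_def
proof (intro conjI allI impI)
  fix us y vs assume "xs @ [z] = us @ y # vs"
  then consider "vs = []" "us = xs" "y = z" | vs' where "xs = us @ y # vs'"
    by (cases vs rule: rev_cases) auto
  then have "fits (fresh us) y \<and> (\<forall>t\<ge>s. status_ok t y)"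
  proof cases
    case 1
    then show ?thesis using assms(3,4) by simp
  next
    case (2 vs')
    then show ?thesis using assms(1) unfolding settled_def by blast
  qed
  then show "fits (fresh us) y" "\<And>t. t \<ge> s \<Longrightarrow> status_ok t y" by auto
qed (use assms in auto)

lemma act_settled:
  assumes "\<forall>us z vs. xs = us @ z # vs \<longrightarrow> fits (p + length (flat us)) z \<and> status_ok s z"
  shows "act s N p (xs @ ys) = xs @ act s N (p + length (flat xs)) ys"
  using assms
proof (induction xs arbitrary: p)
  case (Cons x xs)
  have "fits p x" "status_ok s x" using Cons.prems[rule_format, of "[]" x xs] by simp_all
  moreover have "\<forall>us z vs. xs = us @ z # vs \<longrightarrow>
      fits (p + length (elems x) + length (flat us)) z \<and> status_ok s z"
    using Cons.prems[rule_format, of "x # us" for us] by (simp add: add.assoc)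
  ultimately show ?case using Cons.IH[of "p + length (elems x)"] by (simp add: add.assoc)
qed simp

lemma B_Suc_settled:
  assumes "settled s xs" "B s = xs @ ys"
  shows "\<exists>w. B (Suc s) = xs @ act s (fresh (B s)) (fresh xs) ys @ [w]"
proof -
  have "act s (fresh (B s)) i0 (B s) = xs @ act s (fresh (B s)) (fresh xs) ys"
    using act_settled[of xs i0 s] assms unfolding settled_def fresh_def by simp
  then show ?thesis by (simp add: Let_def)
qed

text \<open>The scan of \<open>act\<close> passes over a settled prefix: its items fit, and none of
  them gets a wrong status later. Settled prefixes are therefore final parts of the copy.\<close>

lemma settled_Suc: assumes "settled s xs" shows "settled (Suc s) xs"
proof -
  obtain ys where "B s = xs @ ys" using assms unfolding settled_def prefix_def by blast
  from B_Suc_settled[OF assms this] have "prefix xs (B (Suc s))" by auto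
  then show ?thesis using assms unfolding settled_def by auto
qed

lemma settled_mono: "s \<le> t \<Longrightarrow> settled s xs \<Longrightarrow> settled t xs"
  by (induction t rule: dec_induct) (auto intro: settled_Suc)

text \<open>Everything before \<open>z\<close> being settled, each stage until \<open>z\<close> fits
  inserts one block directly before it and so advances it to the next boundary. The induction is on
  the distance to a boundary \<open>p\<close> at which the pattern of \<open>z\<close> occurs;
  recurrence provides such a \<open>p\<close>.\<close>

lemma eventually_fits:
  assumes "settled s xs" "B s = xs @ z # zs"
  shows "\<exists>t xs' ws. s \<le> t \<and> B t = xs' @ z # zs @ ws \<and> settled t xs' \<and> prefix xs xs' \<and> fits (fresh xs') z"
proof -
  have "valid z" using B_inv(2)[of s] assms(2) by simp
  then have "infinite {p. boundary f p \<and> fits p z}"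
    using valid_recurrent unfolding recurrent_pattern_def fits_def by blast
  then obtain p where p: "p \<ge> fresh xs" "boundary f p" "fits p z"
    unfolding infinite_nat_iff_unbounded_le by blast
  show ?thesis using assms p(1)
  proof (induction "p - fresh xs" arbitrary: s xs zs rule: less_induct)
    case less
    show ?case
    proof (cases "fits (fresh xs) z")
      case True
      then show ?thesis using less.prems by (intro exI[of _ s] exI[of _ xs] exI[of _ "[]"]) simp
    next
      case False
      let ?F = "filler (fresh xs) (fresh (B s))"
      obtain w where w: "B (Suc s) = xs @ ?F # z # zs @ [w]"
        using B_Suc_settled[OF less.prems(1,2)] False by auto
      have "fresh xs < p" using False p less.prems(3) le_neq_implies_less by blast
      \<comment> \<open>\<open>p\<close> is itself a boundary, so the advance cannot jump over
        it.\<close>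
      then have le: "next_boundary f (fresh xs) \<le> p" using p(2) by (rule next_boundary)
      have fr: "fresh (xs @ [?F]) = next_boundary f (fresh xs)"
        using next_boundary(1)[of "fresh xs"] by (simp add: fresh_def filler_def)
      have "settled (Suc s) (xs @ [?F])"
        by (rule settled_snoc[OF settled_Suc[OF less.prems(1)]])
          (use w fits_filler in \<open>auto simp: status_ok_def filler_def\<close>)
      moreover have "p - fresh (xs @ [?F]) < p - fresh xs"
        using fr \<open>fresh xs < p\<close> next_boundary(1)[of "fresh xs"] by simp
      moreover have "B (Suc s) = (xs @ [?F]) @ z # (zs @ [w])" using w by simp
      ultimately obtain t xs' ws where "Suc s \<le> t" "B t = xs' @ z # (zs @ [w]) @ ws"
        "settled t xs'" "prefix (xs @ [?F]) xs'" "fits (fresh xs') z"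
        using less.hyps[of "xs @ [?F]" "Suc s" "zs @ [w]"] le fr by auto
      then show ?thesis
        by (intro exI[of _ t] exI[of _ xs'] exI[of _ "w # ws"]) (auto dest: append_prefixD)
    qed
  qed
qed

definition converged :: "nat \<Rightarrow> item \<Rightarrow> bool" where
  "converged s z \<longleftrightarrow> (tag z \<noteq> 0 \<longrightarrow> (\<forall>t\<ge>s. As (tag z - 1) t \<longleftrightarrow> tag z - 1 \<in> A))"

lemma converged_mono: "converged s z \<Longrightarrow> s \<le> t \<Longrightarrow> converged t z"
  by (auto simp: converged_def)

text \<open>Once \<open>z\<close> fits, a wrong status costs a single growth: the parity flips and
  the guess has converged. Growth may destroy the fit, so the fitting argument is applied a second
  time.\<close>

lemma eventually_settled_item:
  assumes "settled s xs" "B s = xs @ z # zs" "converged s z"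
  shows "\<exists>t xs' z' ws. s \<le> t \<and> B t = xs' @ z' # zs @ ws \<and> settled t (xs' @ [z']) \<and>
    prefix xs xs' \<and> descendant z z'"
proof -
  have settle: "\<exists>t xs' ws. s \<le> t \<and> B t = xs' @ z # zs @ ws \<and> settled t (xs' @ [z]) \<and> prefix xs xs'"
    if "settled s xs" "B s = xs @ z # zs" "\<forall>t\<ge>s. status_ok t z" for s xs z zs
  proof -
    note prems = that
    obtain t xs' ws where t: "s \<le> t" "B t = xs' @ z # zs @ ws" "settled t xs'" "prefix xs xs'"
      "fits (fresh xs') z" using eventually_fits[OF prems(1,2)] by blast
    have "settled t (xs' @ [z])" by (rule settled_snoc) (use t prems(3) in auto)
    then show ?thesis using t by blast
  qed
  obtain t xs' ws where t: "s \<le> t" "B t = xs' @ z # zs @ ws" "settled t xs'" "prefix xs xs'"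
    "fits (fresh xs') z" using eventually_fits[OF assms(1,2)] by blast
  show ?thesis
  proof (cases "status_ok t z")
    case True
    then have "\<forall>u\<ge>t. status_ok u z" using assms(3) t(1) by (auto simp: status_ok_def converged_def)
    from settle[OF t(3,2) this] show ?thesis
      using t(1,4) descendant_refl by (metis append.assoc order_trans prefix_order.order_trans)
  next
    case False
    let ?z = "grow (fresh (B t)) z"
    have tag: "tag z \<noteq> 0" using False by (auto simp: status_ok_def)
    obtain w where w: "B (Suc t) = xs' @ ?z # (zs @ ws @ [w])"
      using B_Suc_settled[OF t(3,2)] t(5) False by auto
    have "\<forall>u\<ge>Suc t. status_ok u ?z"
      using False assms(3) t(1) by (auto simp: status_ok_def converged_def grow_def)
    from settle[OF settled_Suc[OF t(3)] w this] obtain u xs'' ws' where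
      "Suc t \<le> u" "B u = xs'' @ ?z # (zs @ ws @ [w]) @ ws'" "settled u (xs'' @ [?z])" "prefix xs' xs''"
      by blast
    then show ?thesis using t(1,4) descendant_grow[OF tag]
      by (intro exI[of _ u] exI[of _ xs''] exI[of _ ?z] exI[of _ "ws @ [w] @ ws'"]) auto
  qed
qed

lemma eventually_settled_items:
  "settled s xs \<Longrightarrow> B s = xs @ zs @ ws \<Longrightarrow> \<forall>z\<in>set zs. converged s z \<Longrightarrow>
   \<exists>t xs'. s \<le> t \<and> settled t xs' \<and> prefix xs xs' \<and> (\<forall>z\<in>set zs. \<exists>z'\<in>set xs'. descendant z z')"
proof (induction zs arbitrary: s xs ws)
  case (Cons z zs)
  obtain t xs' z' ws' where t: "s \<le> t" "B t = xs' @ z' # (zs @ ws) @ ws'" "settled t (xs' @ [z'])"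
    "prefix xs xs'" "descendant z z'"
    using eventually_settled_item[of s xs z "zs @ ws"] Cons.prems by auto
  have "B t = (xs' @ [z']) @ zs @ (ws @ ws')" using t by simp
  moreover have "\<forall>z\<in>set zs. converged t z" using Cons.prems(3) t(1) converged_mono by auto
  ultimately obtain u xs'' where u: "t \<le> u" "settled u xs''" "prefix (xs' @ [z']) xs''"
    "\<forall>z\<in>set zs. \<exists>z'\<in>set xs''. descendant z z'"
    using Cons.IH[OF t(3)] by blast
  have "z' \<in> set xs''" using u(3) by (auto simp: prefix_def)
  then show ?case using t u
    by (intro exI[of _ u] exI[of _ xs'']) (auto dest: append_prefixD prefix_order.order_trans)
qed auto

lemma append_Cons_eq_append:
  assumes "P @ Q = us @ z # vs"
  shows "(\<exists>P2. P = us @ z # P2 \<and> vs = P2 @ Q) \<or> (\<exists>U. us = P @ U \<and> Q = U @ z # vs)"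
  using assms by (auto simp: append_eq_append_conv2 append_eq_Cons_conv Cons_eq_append_conv)

text \<open>New areas are only appended at the right end, and whatever is inserted among old items
  is a filler. So the descendants of \<open>B s\<close> lie in an initial part \<open>P\<close>
  whose areas code old numbers only.\<close>

lemma split_old_new:
  assumes "s \<le> t"
  shows "\<exists>P Q. B t = P @ Q \<and> tag ` set P \<subseteq> insert 0 (tag ` set (B s)) \<and>
    (\<forall>z\<in>set (B s). \<exists>z'\<in>set P. descendant z z')"
  using assms
proof (induction t rule: dec_induct)
  case base
  then show ?case using descendant_refl by (intro exI[of _ "B s"] exI[of _ "[]"]) auto
next
  case (step t)
  then obtain P Q where PQ: "B t = P @ Q" "tag ` set P \<subseteq> insert 0 (tag ` set (B s))"
    "\<forall>z\<in>set (B s). \<exists>z'\<in>set P. descendant z z'" by blast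
  let ?K = "act t (fresh (B t)) i0 (B t)"
  have "\<exists>P' Q'. ?K = P' @ Q' \<and> tag ` set P' \<subseteq> insert 0 (tag ` set P) \<and>
    (\<forall>z\<in>set P. \<exists>z'\<in>set P'. descendant z z')"
  proof (cases rule: act_cases[of t "fresh (B t)" "B t"])
    case unchanged
    then show ?thesis using PQ descendant_refl by (intro exI[of _ P] exI[of _ Q]) auto
  next
    case (fill us z vs)
    from append_Cons_eq_append[OF PQ(1)[symmetric, unfolded fill(1)]] show ?thesis
    proof (elim disjE exE conjE)
      fix P2 assume "P = us @ z # P2" "vs = P2 @ Q"
      then show ?thesis using fill(3) descendant_refl
        by (intro exI[of _ "us @ filler (i0 + length (flat us)) (fresh (B t)) # z # P2"] exI[of _ Q])
          (auto simp: filler_def)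
    next
      fix U assume "us = P @ U"
      then show ?thesis using fill(3) descendant_refl by (intro exI[of _ P] exI[of _ "U @ filler (i0 + length (flat us)) (fresh (B t)) # z # vs"]) auto
    qed
  next
    case (grow us z vs)
    from append_Cons_eq_append[OF PQ(1)[symmetric, unfolded grow(1)]] show ?thesis
    proof (elim disjE exE conjE)
      fix P2 assume "P = us @ z # P2" "vs = P2 @ Q"
      then show ?thesis using grow(3) descendant_refl descendant_grow[OF grow(2)]
        by (intro exI[of _ "us @ local.grow (fresh (B t)) z # P2"] exI[of _ Q])
          (auto simp: grow_def)
    next
      fix U assume "us = P @ U"
      then show ?thesis using grow(3) descendant_refl by (intro exI[of _ P] exI[of _ "U @ local.grow (fresh (B t)) z # vs"]) auto
    qed
  qed
  then obtain P' Q' where P': "?K = P' @ Q'" "tag ` set P' \<subseteq> insert 0 (tag ` set P)"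
    "\<forall>z\<in>set P. \<exists>z'\<in>set P'. descendant z z'" by blast
  show ?case
  proof (intro exI conjI)
    show "B (Suc t) = P' @ (Q' @ [new_area t ?K])" using P'(1) by (simp add: Let_def)
    show "tag ` set P' \<subseteq> insert 0 (tag ` set (B s))" 
      by (rule order_trans[OF P'(2)]) (use PQ(2) in simp)
    show "\<forall>z\<in>set (B s). \<exists>z'\<in>set P'. descendant z z'"
      using PQ(3) P'(3) descendant_trans by blast
  qed
qed

text \<open>It suffices to wait until the guesses for the finitely many areas of \<open>B s\<close>
  have converged: by \<open>split_old_new\<close> the part \<open>P\<close> contains no areas with
  other tags, so its items settle one after the other.\<close>

lemma eventually_settled:
  "\<exists>t xs. s \<le> t \<and> settled t xs \<and> (\<forall>z\<in>set (B s). \<exists>z'\<in>set xs. descendant z z')"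
proof -
  have "\<exists>u\<ge>s. \<forall>z\<in>set zs. converged u z" for zs
  proof (induction zs)
    case (Cons z zs)
    then obtain u where u: "u \<ge> s" "\<forall>z\<in>set zs. converged u z" by blast
    obtain v where "\<forall>t\<ge>v. As (tag z - 1) t \<longleftrightarrow> tag z - 1 \<in> A" using limit by blast
    then have "\<forall>y\<in>set (z # zs). converged (max u v) y"
      using u converged_mono by (auto simp: converged_def)
    then show ?case using u(1) by (meson max.coboundedI1)
  qed auto
  then obtain u where u: "s \<le> u" "\<forall>z\<in>set (B s). converged u z" by blast
  obtain P Q where PQ: "B u = [] @ P @ Q" "tag ` set P \<subseteq> insert 0 (tag ` set (B s))"
    "\<forall>z\<in>set (B s). \<exists>z'\<in>set P. descendant z z'" using split_old_new[OF u(1)] by auto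
  have "converged u z" if "z \<in> set P" for z
  proof -
    have "tag z \<in> insert 0 (tag ` set (B s))" using PQ(2) that by blast
    then show ?thesis using u(2) by (auto simp: converged_def)
  qed
  moreover have "settled u []" by (simp add: settled_def)
  ultimately obtain t xs where "u \<le> t" "settled t xs" "\<forall>z\<in>set P. \<exists>z'\<in>set xs. descendant z z'"
    using eventually_settled_items PQ(1) by blast
  then show ?thesis using u(1) PQ(3) descendant_trans by (meson order_trans)
qed

section \<open>The limit of the stages is a copy of the order\<close>

definition lim_at :: "nat \<Rightarrow> nat \<Rightarrow> bool" where
  "lim_at p x \<longleftrightarrow> (\<exists>s. \<forall>t\<ge>s. p < length (F t) \<and> F t ! p = x)"

definition h :: "nat \<Rightarrow> nat" where
  "h p = (THE x. lim_at p x)"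

lemma lim_at_unique: "lim_at p x \<Longrightarrow> lim_at p y \<Longrightarrow> x = y"
  unfolding lim_at_def by (metis nat_le_linear)

lemma lim_at_settled:
  assumes "settled s xs" "p < length ([0..<i0] @ flat xs)"
  shows "lim_at p (([0..<i0] @ flat xs) ! p)"
  unfolding lim_at_def
proof (intro exI allI impI)
  fix t assume "s \<le> t"
  then have "settled t xs" using assms(1) by (rule settled_mono)
  then obtain ys where "B t = xs @ ys" unfolding settled_def prefix_def by blast
  then have "F t = ([0..<i0] @ flat xs) @ flat ys" by (simp add: F_def)
  then show "p < length (F t) \<and> F t ! p = ([0..<i0] @ flat xs) ! p"
    using assms(2) by (simp only: nth_append) simp
qed

lemma eventually_settled_elements:
  "\<exists>t xs. settled t xs \<and> set (F s) \<subseteq> set ([0..<i0] @ flat xs)"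
proof -
  obtain t xs where t: "settled t xs" "\<forall>z\<in>set (B s). \<exists>z'\<in>set xs. descendant z z'"
    using eventually_settled by blast
  have "set (flat (B s)) \<subseteq> set (flat xs)"
    using t(2) descendant_elems unfolding flat_def by fastforce
  then show ?thesis using t(1) unfolding F_def by (intro exI[of _ t] exI[of _ xs]) auto
qed

lemma lim_at_h: "lim_at p (h p)"
proof -
  obtain t xs where t: "settled t xs" "set (F (Suc p)) \<subseteq> set ([0..<i0] @ flat xs)"
    using eventually_settled_elements by blast
  \<comment> \<open>All elements of stage \<open>Suc p\<close> end up in a settled prefix, and there
    are at least \<open>Suc p\<close> of them, so this prefix reaches beyond position
    \<open>p\<close>.\<close>
  have "Suc p \<le> card (set (F (Suc p)))"
    using length_F[of "Suc p"] F_inv(2)[of "Suc p"] by simp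
  also have "\<dots> \<le> card (set ([0..<i0] @ flat xs))" using t(2) by (intro card_mono) simp_all
  also have "\<dots> \<le> length ([0..<i0] @ flat xs)" by (rule card_length)
  finally have "lim_at p (([0..<i0] @ flat xs) ! p)" using lim_at_settled[OF t(1)] by simp
  then show ?thesis unfolding h_def by (rule theI) (rule lim_at_unique[OF _ \<open>lim_at p _\<close>])
qed

lemma h_eqI: "lim_at p x \<Longrightarrow> h p = x"
  using lim_at_h lim_at_unique by blast

lemma lim_at_settled_item:
  assumes "settled s (xs @ [z])" "x < length (elems z)"
  shows "h (fresh xs + x) = elems z ! x"
  using lim_at_settled[OF assms(1), of "fresh xs + x"] assms(2)
  by (intro h_eqI) (simp add: fresh_def nth_append)

lemma bij_h: "bij h"
proof (rule bijI)
  show "inj h"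
  proof (rule injI)
    fix p q assume hpq: "h p = h q"
    obtain s t where "\<forall>u\<ge>s. p < length (F u) \<and> F u ! p = h p"
      "\<forall>u\<ge>t. q < length (F u) \<and> F u ! q = h q" using lim_at_h unfolding lim_at_def by metis
    then have "p < length (F (max s t))" "F (max s t) ! p = h p"
      "q < length (F (max s t))" "F (max s t) ! q = h q" by simp_all
    then show "p = q" using hpq nth_eq_iff_index_eq[OF F_inv(1)] by metis
  qed
  have "x \<in> range h" for x
  proof -
    have "x \<in> set (F (Suc x))" using F_inv(2) length_F[of "Suc x"] by simp
    then obtain t xs where t: "settled t xs" "x \<in> set ([0..<i0] @ flat xs)"
      using eventually_settled_elements by blast
    then obtain p where p: "p < length ([0..<i0] @ flat xs)" "([0..<i0] @ flat xs) ! p = x"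
      by (meson in_set_conv_nth)
    have "h p = x" using h_eqI[OF lim_at_settled[OF t(1) p(1)]] p(2) by simp
    then show ?thesis by (metis rangeI)
  qed
  then show "surj h" by blast
qed

text \<open>The first alternative stops the search when \<open>x\<close> is absent, so that
  \<open>index\<close> is a total search and hence computable.\<close>

definition index :: "nat \<Rightarrow> nat \<Rightarrow> nat" where
  "index s x = (LEAST i. length (F s) \<le> i \<or> F s ! i = x)"

text \<open>Numbers below \<open>s\<close> are present at stage \<open>s\<close>, so stage
  \<open>Suc (x + y)\<close> contains both elements, and their order never changes
  afterwards.\<close>

definition r :: "nat rel" where
  "r = {(x, y). index (Suc (x + y)) x < index (Suc (x + y)) y}"

lemma index_F:
  assumes "x < s" shows "index s x < length (F s)" "F s ! index s x = x"
proof -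
  have "x \<in> set (F s)" using F_inv(2) length_F[of s] assms by simp
  then obtain i where i: "i < length (F s)" "F s ! i = x" by (meson in_set_conv_nth)
  let ?P = "\<lambda>i. length (F s) \<le> i \<or> F s ! i = x"
  have "?P (index s x)" unfolding index_def by (rule LeastI[of ?P i]) (simp add: i)
  moreover have "index s x \<le> i" unfolding index_def by (rule Least_le) (simp add: i)
  ultimately show "index s x < length (F s)" "F s ! index s x = x" using i(1) by auto
qed

lemma index_less_imp:
  assumes "index s (h p) < index s (h q)" "h p < s" "h q < s"
  shows "p < q"
proof -
  have "subseq [h p, h q] (F s)"
    using subseq_pair_nth[OF assms(1) index_F(1)[OF assms(3)]] index_F assms by simp
  moreover obtain t u where tu: "\<forall>v\<ge>t. p < length (F v) \<and> F v ! p = h p"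
      "\<forall>v\<ge>u. q < length (F v) \<and> F v ! q = h q" using lim_at_h unfolding lim_at_def by metis
  define T where "T = max s (max t u)"
  have "subseq (F s) (F T)" by (rule subseq_F) (simp add: T_def)
  ultimately have "subseq [h p, h q] (F T)" using subseq_order.order_trans by blast
  then obtain i j where "i < j" "j < length (F T)" "F T ! i = h p" "F T ! j = h q"
    using nth_of_subseq_pair by metis
  moreover have "p < length (F T)" "F T ! p = h p" "q < length (F T)" "F T ! q = h q"
    using tu by (simp_all add: T_def)
  ultimately show "p < q" using F_inv(1)[of T]
    by (metis nth_eq_iff_index_eq order_less_trans)
qed

lemma omega_iso_r: "omega_iso r h"
  unfolding omega_iso_def
proof (intro conjI allI)
  show "bij h" by (rule bij_h)
  fix p q
  let ?s = "Suc (h p + h q)"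
  have lt: "h p < ?s" "h q < ?s" by simp_all
  have "(h p, h q) \<in> r \<longleftrightarrow> index ?s (h p) < index ?s (h q)" by (simp add: r_def)
  moreover have "index ?s (h p) \<noteq> index ?s (h q)" if "p \<noteq> q"
    using that index_F(2)[OF lt(1)] index_F(2)[OF lt(2)] bij_h by (metis bij_def injD)
  moreover have "index ?s (h p) = index ?s (h q)" if "p = q" using that by simp
  ultimately show "p < q \<longleftrightarrow> (h p, h q) \<in> r"
    using index_less_imp[of ?s p q] index_less_imp[of ?s q p] lt
    by (metis less_irrefl nat_neq_iff order_less_asym)
qed

section \<open>The image of the function and the coded set\<close>

definition image_fun :: "nat \<Rightarrow> nat" where
  "image_fun x = h (f (inv h x))"

lemma graph_image_iff: "(x, y) \<in> graph_image h f \<longleftrightarrow> image_fun x = y"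
  unfolding graph_image_def image_fun_def
  using bij_h by (auto simp: bij_is_inj bij_is_surj surj_f_inv_f intro: exI[of _ "inv h x"])

lemma image_fun_h: "image_fun (h p) = h (f p)"
  unfolding image_fun_def using bij_h by (simp add: bij_is_inj)

lemma image_fun_prefix: "x < i0 \<Longrightarrow> image_fun x = f x"
proof -
  assume x: "x < i0"
  have s: "settled 0 []" by (simp add: settled_def)
  have "h p = p" if "p < i0" for p
    using lim_at_settled[OF s, of p] that by (intro h_eqI) simp
  moreover have "f x < i0" using x boundary_less[OF boundary_i0] by simp
  ultimately show ?thesis using image_fun_h[of x] x by simp
qed

lemma image_fun_settled:
  assumes "settled s (xs @ [z])" "x < length (elems z)"
  shows "image_fun (elems z ! x) = elems z ! (f (item_loc z + x) - item_loc z)"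
proof -
  have v: "valid z" using assms(1) B_inv(2)[of s] unfolding settled_def prefix_def by auto
  have fits: "fits (fresh xs) z" using assms(1) unfolding settled_def by blast
  define y where "y = f (item_loc z + x) - item_loc z"
  have y: "f (item_loc z + x) = item_loc z + y" "y < length (elems z)"
    using valid_closed[OF v assms(2)] by (simp_all add: y_def)
  have "f (fresh xs + x) + item_loc z = f (item_loc z + x) + fresh xs"
    using fits assms(2) by (simp add: fits_def occurs_at_def same_pattern_def)
  then have "f (fresh xs + x) = fresh xs + y" using y(1) by simp
  moreover have "h (fresh xs + x) = elems z ! x" "h (fresh xs + y) = elems z ! y"
    using lim_at_settled_item[OF assms(1)] assms(2) y(2) by blast+
  ultimately show ?thesis
    using image_fun_h[of "fresh xs + x"] unfolding y_def[symmetric] by simp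
qed

lemma settled_descendant:
  assumes "z \<in> set (B s)"
  obtains t xs z' where "settled t (xs @ [z'])" "descendant z z'"
    "tag z' \<noteq> 0 \<Longrightarrow> odd (age z') \<longleftrightarrow> tag z' - 1 \<in> A" "valid z'"
proof -
  obtain t xs z' where t: "settled t xs" "z' \<in> set xs" "descendant z z'"
    using eventually_settled assms by blast
  obtain us vs where us: "xs = us @ z' # vs" using t(2) by (meson split_list)
  have "settled t (us @ [z'])" by (rule settled_prefix[of _ _ vs]) (use t(1) us in simp)
  moreover have "odd (age z') \<longleftrightarrow> tag z' - 1 \<in> A" if "tag z' \<noteq> 0"
  proof -
    obtain s0 where "\<forall>s\<ge>s0. As (tag z' - 1) s \<longleftrightarrow> tag z' - 1 \<in> A" using limit by blast
    moreover have "status_ok (max s0 t) z'" using settledD(2) t(1) us by simp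
    ultimately show ?thesis using that by (simp add: status_ok_def)
  qed
  moreover have "valid z'" using t(1) us B_inv(2)[of t] unfolding settled_def prefix_def by auto
  ultimately show thesis using that t(3) by blast
qed

text \<open>The item may still be displaced or change its age. A filler is its own descendant; the
  settled descendant of an area has an age of the same parity, both being right about
  \<open>A\<close>, and by \<open>coherent\<close> its pattern agrees with the present one on the
  old elements. This makes the image of \<open>f\<close> computable from \<open>A\<close>.\<close>

lemma image_fun_item:
  assumes z: "z \<in> set (B s)" and status: "tag z \<noteq> 0 \<Longrightarrow> odd (age z) \<longleftrightarrow> tag z - 1 \<in> A"
    and x: "x < length (elems z)"
  shows "image_fun (elems z ! x) = elems z ! (f (item_loc z + x) - item_loc z)"
proof -
  obtain t xs z' where z': "settled t (xs @ [z'])" "descendant z z'"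
    "tag z' \<noteq> 0 \<Longrightarrow> odd (age z') \<longleftrightarrow> tag z' - 1 \<in> A" using settled_descendant[OF z] by metis
  show ?thesis
  proof (cases "z = z'")
    case True
    then show ?thesis using image_fun_settled[OF z'(1)] x by simp
  next
    case False
    then obtain l e where tag: "tag z \<noteq> 0" "tag z = tag z'" "age z \<le> age z'"
      and e: "elems z' = l @ elems z @ e" "length l = off (age z') - off (age z)"
      using z'(2) unfolding descendant_def by blast
    have v: "valid z" using B_inv(2) z by blast
    then have xl: "x < len (age z)" using x tag by (simp add: valid_def)
    define y where "y = f (item_loc z + x) - item_loc z"
    have y: "f (item_loc z + x) = item_loc z + y" "y < length (elems z)"
      using valid_closed[OF v x] by (simp_all add: y_def)
    have "f (item_loc z' + (x + length l)) = item_loc z' + (y + length l)"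
    proof -
      have "f (loc (age z') + (x + length l)) + loc (age z) = f (loc (age z) + x) + loc (age z') + length l"
      proof -
        have "even (age z) \<longleftrightarrow> even (age z')" using z'(3) status tag by fastforce
        then show ?thesis using coherent[OF tag(3) _ xl] by (simp add: e(2))
      qed
      then show ?thesis using y(1) tag by (simp add: item_loc_def)
    qed
    then have "image_fun (elems z' ! (x + length l)) = elems z' ! (y + length l)"
      using image_fun_settled[OF z'(1), of "x + length l"] x e(1) by simp
    then show ?thesis using x y(2) e(1) by (simp add: nth_append y_def)
  qed
qed

text \<open>The status of \<open>z\<close> may be wrong here. Indices move by \<open>off\<close>
  under growth, so the settled descendant has the same two elements as its pair; its parity is right
  about \<open>A\<close> and by \<open>coding\<close> decides whether \<open>f\<close> joins
  them.\<close>

lemma coding_pair: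
  assumes z: "z \<in> set (B s)" "tag z = Suc n"
  shows "image_fun (elems z ! (cx + off (age z))) = elems z ! (cy + off (age z)) \<longleftrightarrow> n \<notin> A"
proof -
  obtain t xs z' where z': "settled t (xs @ [z'])" "descendant z z'"
    "tag z' \<noteq> 0 \<Longrightarrow> odd (age z') \<longleftrightarrow> tag z' - 1 \<in> A" "valid z'" using settled_descendant[OF z(1)] by metis
  have v: "valid z" using B_inv(2) z by blast
  obtain l e where tag: "tag z' = Suc n" and e: "elems z' = l @ elems z @ e"
    "length l = off (age z') - off (age z)" "age z \<le> age z'"
  proof (cases "z = z'")
    case True
    then show thesis using that[of "[]" "[]"] z(2) by simp
  next
    case False
    then show thesis using that z'(2) z(2) unfolding descendant_def by auto
  qed
  have len: "length (elems z) = len (age z)" "length (elems z') = len (age z')"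
    using v z'(4) z(2) tag by (simp_all add: valid_def)
  have "elems z ! (c + off (age z)) = elems z' ! (c + off (age z'))" if "c + off (age z) < len (age z)" for c
  proof -
    have "c + off (age z') = length l + (c + off (age z))" using off_mono[OF e(3)] e(2) by simp
    then show ?thesis using e(1) len that by (simp add: nth_append)
  qed
  note eq = this[OF coding_inside(1)] this[OF coding_inside(2)]
  define y where "y = f (item_loc z' + (cx + off (age z'))) - item_loc z'"
  have x: "cx + off (age z') < length (elems z')" using coding_inside(1) len by simp
  have y: "f (item_loc z' + (cx + off (age z'))) = item_loc z' + y" "y < length (elems z')"
    using valid_closed[OF z'(4) x] by (simp_all add: y_def)
  have "image_fun (elems z' ! (cx + off (age z'))) = elems z' ! y"
    using image_fun_settled[OF z'(1) x] by (simp add: y_def)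
  moreover have "distinct (elems z')"
  proof -
    have "distinct (flat (B t))" using B_inv(1) unfolding all_fresh_def by blast
    then show ?thesis using z'(1) unfolding settled_def prefix_def by auto
  qed
  ultimately have "image_fun (elems z' ! (cx + off (age z'))) = elems z' ! (cy + off (age z')) \<longleftrightarrow>
      y = cy + off (age z')"
    using nth_eq_iff_index_eq y(2) coding_inside(2)[of "age z'"] len(2) by metis
  also have "\<dots> \<longleftrightarrow> even (age z')" using coding[of "age z'"] y(1) tag by (simp add: item_loc_def)
  also have "\<dots> \<longleftrightarrow> n \<notin> A" using z'(3) tag by auto
  finally show ?thesis using eq by simp
qed

lemma area_exists: "\<exists>z\<in>set (B (Suc n)). tag z = Suc n"
  by (simp add: Let_def new_area_def)

lemma item_exists:
  assumes "i0 \<le> x"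
  shows "\<exists>s z. z \<in> set (B s) \<and> (tag z \<noteq> 0 \<longrightarrow> (odd (age z) \<longleftrightarrow> tag z - 1 \<in> A)) \<and> x \<in> set (elems z)"
proof -
  have "x \<in> set (F (Suc x))" using F_inv(2) length_F[of "Suc x"] by simp
  then obtain z where z: "z \<in> set (B (Suc x))" "x \<in> set (elems z)"
    using assms unfolding F_def flat_def by auto
  obtain t xs z' where z': "settled t (xs @ [z'])" "descendant z z'"
    "tag z' \<noteq> 0 \<Longrightarrow> odd (age z') \<longleftrightarrow> tag z' - 1 \<in> A" using settled_descendant[OF z(1)] by metis
  then have "z' \<in> set (B t)" unfolding settled_def prefix_def by auto
  then show ?thesis using z' z(2) descendant_elems by blast
qed

end

section \<open>Computability of the construction\<close>

text \<open>In the first case two patterns of equal size alternate and nothing is ever added. In the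
  periodic case the area grows by two periods at each change, and the old elements alternate between
  two alignments with the period that differ by one.\<close>

lemma (in bounded_gaps) coding_scheme_exists:
  assumes "\<not> almost_identity f"
  shows "\<exists>i0 cx cy loc len off. coding_scheme f M i0 cx cy loc len off \<and>
    (\<forall>orc. computable_in orc loc \<and> computable_in orc len \<and> computable_in orc off)"
proof -
  obtain i0 where i0: "boundary f i0"
    "\<forall>p\<ge>i0. boundary f p \<longrightarrow> recurrent_pattern f p (next_boundary f p - p)"
    using eventually_recurrent_blocks by blast
  show ?thesis
  proof (cases rule: two_patterns_or_periodic[OF assms])
    case (1 a b m x)
    define loc where "loc j = (if even j then a else b)" for j :: nat
    define y where "y = f (a + x) - a"
    have y: "f (a + x) = a + y" "y < m"
      using recurrent_pattern_closed[OF 1(3,5)] by (simp_all add: y_def)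
    have "f (b + x) \<noteq> b + y" using 1(6) y(1) by simp
    then have "coding_scheme f M i0 x y loc (\<lambda>_. m) (\<lambda>_. 0)"
      by unfold_locales (use i0 1 y in \<open>simp_all add: loc_def\<close>)
    moreover have "computable_in orc loc" for orc unfolding loc_def by (intro comp_intros)
    ultimately show ?thesis using computable_in_const by blast
  next
    case (2 a k)
    note k = 2(1) and period = 2(3)
    have shift: "f (x + t * k) = f x + t * k" if "x \<ge> a" for x t
    proof (induction t)
      case (Suc t)
      then show ?case using period[of "x + t * k"] that by (simp add: algebra_simps)
    qed simp
    \<comment> \<open>The shift by one must be visible. If it were not, \<open>f\<close> would
      increase by one at each step through a whole period from \<open>a + (k - 1)\<close> on; the
      boundary at \<open>a + k\<close> forces a fixed point at \<open>a + (k - 1)\<close>, and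
      \<open>f\<close> would be eventually the identity.\<close>
    have "\<exists>u<k. f (a + u + k) \<noteq> Suc (f (a + u + (k - 1)))"
    proof (rule ccontr)
      assume "\<not> ?thesis"
      then have step: "f (a + u + k) = Suc (f (a + u + (k - 1)))" if "u < k" for u
        using that by blast
      have lin: "f (a + (k - 1) + x) = f (a + (k - 1)) + x" if "x \<le> k" for x
        using that
      proof (induction x)
        case (Suc x)
        have e: "a + (k - 1) + Suc x = a + x + k" "a + x + (k - 1) = a + (k - 1) + x" using k by simp_all
        have "f (a + (k - 1) + Suc x) = f (a + x + k)" by (simp only: e)
        also have "\<dots> = Suc (f (a + x + (k - 1)))" by (rule step) (use Suc.prems in simp)
        also have "\<dots> = Suc (f (a + (k - 1) + x))" by (simp only: e)
        also have "\<dots> = f (a + (k - 1)) + Suc x" using Suc by simp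
        finally show ?case .
      qed simp
      have "boundary f (a + k)" using 2(4)[of 1] by simp
      moreover have "f (a + k) = Suc (f (a + (k - 1)))" using step[of 0] k by simp
      ultimately have "f (a + (k - 1)) = a + (k - 1)"
        using boundary_less[of f "a + k" "a + (k - 1)"] boundary_le[of f "a + k" "a + k"] k by simp
      then have fixed: "f (a + (k - 1) + x) = a + (k - 1) + x" if "x \<le> k" for x using lin that by simp
      have "f z = z" if ge: "z \<ge> a + k" for z
      proof -
        obtain w where w: "z = a + k + w" using le_Suc_ex[OF ge] by blast
        define x where "x = a + (k - 1) + Suc (w mod k)"
        have "w mod k + (w div k) * k = w" by (rule mod_div_mult_eq)
        then have z: "z = x + (w div k) * k" using w k by (simp add: x_def)
        have "f x = x" unfolding x_def by (rule fixed) (use k in \<open>simp add: Suc_leI\<close>)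
        moreover have "a \<le> x" by (simp add: x_def)
        ultimately show ?thesis using shift[of x "w div k"] by (simp only: z)
      qed
      then have "{x. f x \<noteq> x} \<subseteq> {..<a + k}" by (auto simp flip: not_le)
      then show False using assms finite_subset unfolding almost_identity_def by blast
    qed
    then obtain u where u: "u < k" "f (a + u + k) \<noteq> Suc (f (a + u + (k - 1)))" by blast
    \<comment> \<open>The window starts with one period and takes in \<open>2 * k\<close> elements
      per change. \<open>off\<close> counts \<open>k\<close> per change, less one at odd ages:
      between ages of equal parity the old elements move by a multiple of \<open>k\<close>,
      otherwise they miss one by a single place.\<close>
    define len where "len j = (2 * j + 1) * k" for j :: nat
    define off where "off j = (if even j then j * k else j * k - 1)" for j :: nat
    define y where "y = f (a + u) - a"
    have y: "f (a + u) = a + y" "y < k"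
      using boundary_le[OF 2(2), of "a + u"] boundary_less[OF 2(4)[of 1], of "a + u"] u(1)
      by (simp_all add: y_def)
    have off_less: "c + off j < len j" if "c < k" for c j
      using that unfolding off_def len_def by (auto simp: algebra_simps)
    have "coding_scheme f M i0 u y (\<lambda>_. a) len off"
    proof unfold_locales
      show "boundary f i0" by (rule i0)
      show "recurrent_pattern f p (next_boundary f p - p)" if "i0 \<le> p" "boundary f p" for p
        using i0(2) that by blast
      show "recurrent_pattern f a (len j)" for j
      proof -
        have "occurs_at f a (len j) (a + t * k)" for t
          using 2(4)[of "t + (2 * j + 1)"] shift[of "a + x" t for x]
          by (simp add: occurs_at_def same_pattern_def len_def algebra_simps)
        then have "range (\<lambda>t. a + t * k) \<subseteq> {p. boundary f p \<and> occurs_at f a (len j) p}"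
          using 2(4) by blast
        moreover have "infinite (range (\<lambda>t. a + t * k))"
          using k by (intro range_inj_infinite injI) simp
        ultimately show ?thesis unfolding recurrent_pattern_def using finite_subset by blast
      qed
      show "off j \<le> off (Suc j)" "len j + off (Suc j) \<le> len (Suc j) + off j" for j
        using k unfolding off_def len_def by (auto simp: algebra_simps)
      show "f (a + (x + (off j' - off j))) + a = f (a + x) + a + (off j' - off j)"
        if "j \<le> j'" "even j \<longleftrightarrow> even j'" for x j j'
      proof -
        have "off j' - off j = (j' - j) * k"
        proof (cases "even j")
          case True
          then show ?thesis using that by (simp add: off_def diff_mult_distrib)
        next
          case False
          then have "0 < j" by (cases j) auto
          then have "1 \<le> j * k" "j * k \<le> j' * k" using k that(1) by (simp_all add: Suc_leI)
          then show ?thesis using False that by (simp add: off_def diff_mult_distrib)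
        qed
        then show ?thesis using shift[of "a + x" "j' - j"] by (simp add: add.assoc)
      qed
      show "f (a + (u + off j)) = a + (y + off j) \<longleftrightarrow> even j" for j
      proof (cases "even j")
        case True
        then show ?thesis using shift[of "a + u" j] y(1) by (simp add: off_def add.assoc)
      next
        case False
        then obtain i where j: "j = Suc i" by (cases j) auto
        have off: "off j = (k - 1) + i * k" using False j k by (simp add: off_def)
        have "f (a + (u + off j)) = f (a + u + (k - 1)) + i * k"
          using shift[of "a + u + (k - 1)" i] off by (simp add: add.assoc)
        moreover have "f (a + u + k) = a + y + k" using shift[of "a + u" 1] y(1) by simp
        ultimately show ?thesis using u(2) False off k by auto
      qed
      show "u + off j < len j" "y + off j < len j" for j using off_less u(1) y(2) by blast+
    qed
    moreover have "computable_in orc len" "computable_in orc off" for orc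
      unfolding len_def off_def by (intro comp_intros)+
    ultimately show ?thesis using computable_in_const by blast
  qed
qed

section \<open>Computability of the stages and the two reductions\<close>

instantiation item :: coded
begin
definition "enc_item z = enc (tag z, age z, elems z)"
definition "dec_item n = (let p = dec n in Item (fst p) (fst (snd p)) (snd (snd p)))"
instance by standard (simp_all add: enc_item_def dec_item_def Let_def)
end

lemma computable_in_Item [comp_intros]:
  assumes "computable_in orc t" "computable_in orc j" "computable_in orc e"
  shows "computable_in orc (\<lambda>x. Item (t x) (j x) (e x))"
  using computable_in_Pair[OF assms(1) computable_in_Pair[OF assms(2,3)]]
  by (simp add: computable_in_def enc_item_def)

lemma computable_in_item_sel [comp_intros]:
  assumes "computable_in orc g"
  shows "computable_in orc (\<lambda>x. tag (g x))" "computable_in orc (\<lambda>x. age (g x))"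
    "computable_in orc (\<lambda>x. elems (g x))"
proof -
  have "computable_in orc (\<lambda>x. (tag (g x), age (g x), elems (g x)))"
    using assms by (simp add: computable_in_def enc_item_def)
  from computable_in_fst[OF this] computable_in_fst[OF computable_in_snd[OF this]]
    computable_in_snd[OF computable_in_snd[OF this]]
  show "computable_in orc (\<lambda>x. tag (g x))" "computable_in orc (\<lambda>x. age (g x))"
    "computable_in orc (\<lambda>x. elems (g x))" by simp_all
qed

lemma computable_in_flat [comp_intros]:
  assumes "computable_in orc g" shows "computable_in orc (\<lambda>x. flat (g x))"
proof -
  have "flat zs = foldl (\<lambda>r z. r @ elems z) [] zs" for zs
    by (induction zs rule: rev_induct) simp_all
  then show ?thesis by (rule computable_in_eqI) (intro comp_intros assms)
qed

lemma recursive_in_char_fun_iff: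
  "recursive_in orc (char_fun S) \<longleftrightarrow> decidable_in orc (\<lambda>x. x \<in> S)"
  unfolding decidable_in_def computable_in_def char_fun_def[abs_def] by simp

lemma recursive_in_char_fun_rel_iff:
  "recursive_in orc (char_fun (prod_encode ` R)) \<longleftrightarrow> decidable_in orc (\<lambda>p. p \<in> R)"
proof -
  have "n \<in> prod_encode ` R \<longleftrightarrow> prod_decode n \<in> R" for n
    by (metis image_iff prod_decode_inverse prod_encode_inverse)
  then show ?thesis
    unfolding decidable_in_def computable_in_def char_fun_def[abs_def]
    by (simp add: dec_prod_def)
qed

lemma decidable_in_oracle: "decidable_in (char_fun S) (\<lambda>x. x \<in> S)"
  unfolding recursive_in_char_fun_iff[symmetric] recursive_in_def
  by (rule partial_recursive_in.oracle_call)

lemma decidable_in_comp2: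
  assumes "decidable_in orc (\<lambda>p. P (fst p) (snd p))" "computable_in orc g" "computable_in orc k"
  shows "decidable_in orc (\<lambda>x. P (g x) (k x))"
  using decidable_in_comp[OF assms(1) computable_in_Pair[OF assms(2,3)]] by simp

locale computable_construction = coding_construction +
  assumes computable_f: "computable_in (\<lambda>_. 0) f"
    and computable_scheme: "computable_in (\<lambda>_. 0) loc" "computable_in (\<lambda>_. 0) len" "computable_in (\<lambda>_. 0) off"
    and decidable_As: "decidable_in (\<lambda>_. 0) (\<lambda>p. As (fst p) (snd p))"
begin

lemmas computable_param =
  computable_in_comp[OF computable_in_mono[OF computable_f]]
  computable_in_comp[OF computable_in_mono[OF computable_scheme(1)]]
  computable_in_comp[OF computable_in_mono[OF computable_scheme(2)]]
  computable_in_comp[OF computable_in_mono[OF computable_scheme(3)]]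

lemma decidable_in_As:
  "computable_in orc g \<Longrightarrow> computable_in orc k \<Longrightarrow> decidable_in orc (\<lambda>x. As (g x) (k x))"
  using decidable_in_comp[OF decidable_in_mono[OF decidable_As] computable_in_Pair] by simp

lemma decidable_in_boundary:
  "computable_in orc g \<Longrightarrow> decidable_in orc (\<lambda>x. boundary f (g x))"
  by (rule decidable_in_comp[of _ "boundary f"], subst boundary_bounded[abs_def])
    (intro comp_intros computable_param)

lemma computable_in_next_boundary:
  "computable_in orc g \<Longrightarrow> computable_in orc (\<lambda>x. next_boundary f (g x))"
proof (rule computable_in_comp[of _ "next_boundary f"])
  show "computable_in orc (next_boundary f)"
    unfolding next_boundary_def[abs_def]
    by (intro comp_intros decidable_in_boundary) (use ex_next in blast)
qed

lemma computable_in_item_loc: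
  assumes "computable_in orc g" shows "computable_in orc (\<lambda>x. item_loc (g x))"
  unfolding item_loc_def by (intro comp_intros computable_param assms)

lemma decidable_in_fits:
  assumes "computable_in orc g" "computable_in orc k" shows "decidable_in orc (\<lambda>x. fits (g x) (k x))"
  by (rule decidable_in_comp2[OF _ assms],
      unfold fits_def occurs_at_def same_pattern_def)
    (intro comp_intros computable_param decidable_in_boundary computable_in_item_loc)

lemma decidable_in_status_ok:
  assumes "computable_in orc g" "computable_in orc k" shows "decidable_in orc (\<lambda>x. status_ok (g x) (k x))"
  unfolding status_ok_def by (intro comp_intros decidable_in_As assms)

lemma computable_in_filler:
  assumes "computable_in orc g" "computable_in orc k" shows "computable_in orc (\<lambda>x. filler (g x) (k x))"
  unfolding filler_def by (intro comp_intros computable_in_next_boundary assms)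

lemma computable_in_grow:
  assumes "computable_in orc g" "computable_in orc k" shows "computable_in orc (\<lambda>x. grow (g x) (k x))"
  unfolding grow_def by (intro comp_intros computable_param assms)

text \<open>
  The accumulator holds a flag telling whether the action has taken place, the current position
  and the items already produced.
\<close>

definition act_step :: "nat \<Rightarrow> nat \<Rightarrow> nat \<times> nat \<times> item list \<Rightarrow> item \<Rightarrow> nat \<times> nat \<times> item list" where
  "act_step s N a z =
    (if fst a = 1 then (1, fst (snd a), snd (snd a) @ [z])
     else if \<not> fits (fst (snd a)) z then (1, fst (snd a), snd (snd a) @ [filler (fst (snd a)) N, z])
     else if \<not> status_ok s z then (1, fst (snd a), snd (snd a) @ [grow N z])
     else (0, fst (snd a) + length (elems z), snd (snd a) @ [z]))"

lemma act_foldl: "act s N p zs = snd (snd (foldl (act_step s N) (0, p, []) zs))"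
proof -
  have 1: "foldl (act_step s N) (1, p, out) zs = (1, p, out @ zs)" for p out zs
    by (induction zs arbitrary: out) (simp_all add: act_step_def)
  have "snd (snd (foldl (act_step s N) (0, p, out) zs)) = out @ act s N p zs" for out
  proof (induction zs arbitrary: p out)
    case (Cons z zs)
    have "act_step s N (0, p, out) z =
      (if \<not> fits p z then (1, p, out @ [filler p N, z])
       else if \<not> status_ok s z then (1, p, out @ [grow N z])
       else (0, p + length (elems z), out @ [z]))" by (simp add: act_step_def)
    then show ?case using Cons by (simp add: 1 del: One_nat_def)
  qed simp
  then show ?thesis by simp
qed

lemma computable_in_act:
  assumes "computable_in orc s" "computable_in orc N" "computable_in orc p" "computable_in orc zs"
  shows "computable_in orc (\<lambda>x. act (s x) (N x) (p x) (zs x))"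
  unfolding act_foldl act_step_def
  by (intro comp_intros decidable_in_fits decidable_in_status_ok computable_in_filler
      computable_in_grow assms assms[THEN computable_in_comp])

lemma computable_in_B:
  assumes "computable_in orc g" shows "computable_in orc (\<lambda>x. B (g x))"
proof -
  have "B s = rec_nat [] (\<lambda>s zs. act s (fresh zs) i0 zs @ [new_area s (act s (fresh zs) i0 zs)]) s" for s
    by (induction s) (simp_all add: Let_def)
  then show ?thesis
    by (rule computable_in_eqI, unfold fresh_def new_area_def)
      (intro comp_intros computable_in_act computable_param assms)
qed

lemma computable_in_F:
  assumes "computable_in orc g" shows "computable_in orc (\<lambda>x. F (g x))"
  unfolding F_def by (intro comp_intros computable_in_B assms)

lemma computable_in_index:
  assumes "computable_in orc g" "computable_in orc k" shows "computable_in orc (\<lambda>x. index (g x) (k x))"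
proof (rule computable_in_comp2[OF _ assms])
  have "index s x = (LEAST i. length (F s) \<le> i \<or> hd (drop i (F s)) = x)" for s x
    unfolding index_def by (intro arg_cong[of _ _ Least] ext) (metis hd_drop_conv_nth linorder_not_le)
  then show "computable_in orc (\<lambda>p. index (fst p) (snd p))"
    by (rule computable_in_eqI) (intro comp_intros computable_in_F, blast)
qed

lemma computable_rel_r: "computable_rel r"
  unfolding computable_rel_def computable_set_def computable_def recursive_in_char_fun_rel_iff
  by (simp add: r_def split_beta) (intro comp_intros computable_in_index)

text \<open>\<open>w\<close> consists of the index of an item, the stage, and the index of
  \<open>x\<close> in the item. The last conjunct is the only question to the oracle
  \<open>A\<close>; the alternative \<open>x < i0\<close> makes the search total.\<close>

definition found :: "nat \<Rightarrow> nat \<times> nat \<times> nat \<Rightarrow> bool" where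
  "found x w \<longleftrightarrow> x < i0 \<or> fst w < length (B (fst (snd w))) \<and>
    (let z = hd (drop (fst w) (B (fst (snd w)))) in
      snd (snd w) < length (elems z) \<and> hd (drop (snd (snd w)) (elems z)) = x \<and>
      (tag z \<noteq> 0 \<longrightarrow> (odd (age z) \<longleftrightarrow> tag z - 1 \<in> A)))"

lemma image_fun_search:
  "image_fun x = (if x < i0 then f x else
     let w = dec (LEAST n. found x (dec n)); z = hd (drop (fst w) (B (fst (snd w))))
     in hd (drop (f (item_loc z + snd (snd w)) - item_loc z) (elems z)))"
  "\<exists>n. found x (dec n)"
proof -
  have ex: "\<exists>n. found x (dec n)"
  proof (cases "x < i0")
    case False
    then obtain s z where z: "z \<in> set (B s)" "x \<in> set (elems z)"
      "tag z \<noteq> 0 \<longrightarrow> (odd (age z) \<longleftrightarrow> tag z - 1 \<in> A)" using item_exists[of x] by auto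
    then obtain i j where "i < length (B s)" "B s ! i = z" "j < length (elems z)" "elems z ! j = x"
      by (meson in_set_conv_nth)
    then have "found x (i, s, j)" using z(3) by (simp add: found_def hd_drop_conv_nth)
    then show ?thesis by (metis dec_enc)
  qed (simp add: found_def)
  then show "\<exists>n. found x (dec n)" .
  show "image_fun x = (if x < i0 then f x else
     let w = dec (LEAST n. found x (dec n)); z = hd (drop (fst w) (B (fst (snd w))))
     in hd (drop (f (item_loc z + snd (snd w)) - item_loc z) (elems z)))"
  proof (cases "x < i0")
    case False
    define w :: "nat \<times> nat \<times> nat" where "w = dec (LEAST n. found x (dec n))"
    define z where "z = hd (drop (fst w) (B (fst (snd w))))"
    have "found x w" unfolding w_def using ex by (rule LeastI_ex)
    then have w: "fst w < length (B (fst (snd w)))" "snd (snd w) < length (elems z)"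
      "elems z ! snd (snd w) = x" "tag z \<noteq> 0 \<longrightarrow> (odd (age z) \<longleftrightarrow> tag z - 1 \<in> A)"
      using False unfolding found_def z_def[symmetric] by (auto simp: Let_def hd_drop_conv_nth)
    have z: "z \<in> set (B (fst (snd w)))" using w(1) by (simp add: z_def hd_drop_conv_nth)
    have "f (item_loc z + snd (snd w)) - item_loc z < length (elems z)"
      using valid_closed(2)[of z "snd (snd w)"] valid_closed(1)[of z "snd (snd w)"] B_inv(2) z w(2) by fastforce
    then show ?thesis
      using image_fun_item[OF z _ w(2)] w(3,4) False unfolding w_def[symmetric] z_def[symmetric] Let_def
      by (simp add: hd_drop_conv_nth)
  qed (simp add: image_fun_prefix)
qed

lemma computable_in_image_fun: "computable_in (char_fun A) image_fun"
proof -
  note rules = comp_intros computable_in_B computable_param computable_in_item_loc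
    decidable_in_comp[OF decidable_in_oracle[of A]] computable_in_dec
  have "decidable_in (char_fun A) (\<lambda>p. found (fst p) (dec (snd p)))"
    unfolding found_def Let_def by (intro rules)
  then have "computable_in (char_fun A) (\<lambda>x. LEAST n. found x (dec n))"
    using image_fun_search(2) by (rule computable_in_Least)
  note rules' = rules this
  show ?thesis
    by (rule computable_in_eqI[OF image_fun_search(1)], unfold Let_def) (intro rules')
qed

lemma graph_le: "prod_encode ` graph_image h f \<le>\<^sub>T A"
proof -
  have "p \<in> graph_image h f \<longleftrightarrow> image_fun (fst p) = snd p" for p
    using graph_image_iff[of "fst p" "snd p"] by simp
  then show ?thesis
    unfolding turing_le_def recursive_in_char_fun_rel_iff
    by simp (intro comp_intros computable_in_comp[OF computable_in_image_fun])
qed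

text \<open>Any stage of the area for \<open>n\<close> will do, since \<open>coding_pair\<close>
  holds at every stage; a single query about the pair found there decides.\<close>

lemma le_graph: "A \<le>\<^sub>T prod_encode ` graph_image h f"
proof -
  let ?orc = "char_fun (prod_encode ` graph_image h f)"
  let ?P = "\<lambda>n (w :: nat \<times> nat). fst w < length (B (snd w)) \<and> tag (hd (drop (fst w) (B (snd w)))) = Suc n"
  let ?W = "\<lambda>n. dec (LEAST k. ?P n (dec k)) :: nat \<times> nat"
  let ?z = "\<lambda>n. hd (drop (fst (?W n)) (B (snd (?W n))))"
  let ?pair = "\<lambda>n. (hd (drop (cx + off (age (?z n))) (elems (?z n))),
                    hd (drop (cy + off (age (?z n))) (elems (?z n))))"
  have ex: "\<exists>k. ?P n (dec k)" for n
  proof -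
    obtain z where "z \<in> set (B (Suc n))" "tag z = Suc n" using area_exists by blast
    then obtain i where "i < length (B (Suc n))" "B (Suc n) ! i = z" by (meson in_set_conv_nth)
    then have "?P n (i, Suc n)" using \<open>tag z = _\<close> by (simp add: hd_drop_conv_nth)
    then show ?thesis by (metis dec_enc)
  qed
  have correct: "n \<in> A \<longleftrightarrow> ?pair n \<notin> graph_image h f" for n
  proof -
    have W: "?P n (?W n)" using ex by (rule LeastI_ex)
    then have z: "?z n \<in> set (B (snd (?W n)))" "tag (?z n) = Suc n"
      by (metis (no_types, lifting) hd_drop_conv_nth nth_mem, blast)
    have "length (elems (?z n)) = len (age (?z n))" using B_inv(2) z by (fastforce simp: valid_def)
    then have "?pair n = (elems (?z n) ! (cx + off (age (?z n))), elems (?z n) ! (cy + off (age (?z n))))"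
      using coding_inside[of "age (?z n)"] by (simp only: hd_drop_conv_nth)
    then show ?thesis using coding_pair[OF z] graph_image_iff by simp
  qed
  have query: "decidable_in ?orc (\<lambda>p. p \<in> graph_image h f)"
    using turing_le_refl[of "prod_encode ` graph_image h f"]
    unfolding turing_le_def recursive_in_char_fun_rel_iff .
  have "decidable_in ?orc (\<lambda>n. ?pair n \<notin> graph_image h f)"
    by (intro comp_intros computable_in_B computable_in_dec computable_param ex
        decidable_in_comp[OF query])
  then show ?thesis unfolding turing_le_def recursive_in_char_fun_iff correct .
qed

end


section \<open>Delta_2 sets as limits of computable guesses\<close>

lemma sigma2_iff:
  "sigma2 A \<longleftrightarrow> (\<exists>P :: nat \<times> nat \<times> nat \<Rightarrow> bool. decidable_in (\<lambda>_. 0) P \<and> A = {x. \<exists>y. \<forall>z. P (x, y, z)})"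
  "pi2 A \<longleftrightarrow> (\<exists>P :: nat \<times> nat \<times> nat \<Rightarrow> bool. decidable_in (\<lambda>_. 0) P \<and> A = {x. \<forall>y. \<exists>z. P (x, y, z)})"
proof -
  have enc: "prod_encode (x, prod_encode (y, z)) = enc (x, y, z)" for x y z :: nat
    by (simp add: enc_prod_def)
  have R: "computable_set R \<longleftrightarrow> decidable_in (\<lambda>_. 0) (\<lambda>p :: nat \<times> nat \<times> nat. enc p \<in> R)" for R
    unfolding computable_set_def computable_def recursive_in_char_fun_iff
    unfolding decidable_in_def computable_in_def by simp
  have P: "(\<exists>R. \<Phi> (\<lambda>p. enc p \<in> R)) \<longleftrightarrow> (\<exists>P. \<Phi> P)" for \<Phi> :: "(nat \<times> nat \<times> nat \<Rightarrow> bool) \<Rightarrow> bool"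
  proof
    assume "\<exists>P. \<Phi> P"
    then obtain P where "\<Phi> P" by blast
    moreover have "P = (\<lambda>p. enc p \<in> {n. P (dec n)})" by simp
    ultimately show "\<exists>R. \<Phi> (\<lambda>p. enc p \<in> R)" by metis
  qed blast
  show "sigma2 A \<longleftrightarrow> (\<exists>P :: nat \<times> nat \<times> nat \<Rightarrow> bool. decidable_in (\<lambda>_. 0) P \<and> A = {x. \<exists>y. \<forall>z. P (x, y, z)})"
    unfolding sigma2_def enc R
    by (rule P[of "\<lambda>P. decidable_in (\<lambda>_. 0) P \<and> A = {x. \<exists>y. \<forall>z. P (x, y, z)}"])
  show "pi2 A \<longleftrightarrow> (\<exists>P :: nat \<times> nat \<times> nat \<Rightarrow> bool. decidable_in (\<lambda>_. 0) P \<and> A = {x. \<forall>y. \<exists>z. P (x, y, z)})"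
    unfolding pi2_def enc R
    by (rule P[of "\<lambda>P. decidable_in (\<lambda>_. 0) P \<and> A = {x. \<forall>y. \<exists>z. P (x, y, z)}"])
qed

text \<open>
  Stage \<open>s\<close> guesses that the least \<open>y < s\<close> that still looks like a witness, of membership or of
  non-membership, is one.
\<close>

lemma limit_lemma:
  assumes "delta2 A"
  shows "\<exists>As :: nat \<Rightarrow> nat \<Rightarrow> bool. decidable_in (\<lambda>_. 0) (\<lambda>p. As (fst p) (snd p)) \<and>
    (\<forall>n. \<exists>s0. \<forall>s\<ge>s0. As n s \<longleftrightarrow> n \<in> A)"
proof -
  obtain P :: "nat \<times> nat \<times> nat \<Rightarrow> bool" where P: "decidable_in (\<lambda>_. 0) P" "A = {x. \<exists>y. \<forall>z. P (x, y, z)}"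
    using assms unfolding delta2_def sigma2_iff by blast
  obtain Q :: "nat \<times> nat \<times> nat \<Rightarrow> bool" where Q: "decidable_in (\<lambda>_. 0) Q" "A = {x. \<forall>y. \<exists>z. Q (x, y, z)}"
    using assms unfolding delta2_def sigma2_iff by blast
  define E where "E x s y \<longleftrightarrow> (\<forall>z<s. P (x, y, z))" for x s y
  define D where "D x s y \<longleftrightarrow> (\<forall>z<s. \<not> Q (x, y, z))" for x s y
  define m where "m x s = (LEAST y. s \<le> y \<or> E x s y \<or> D x s y)" for x s
  show ?thesis
  proof (intro exI[of _ "\<lambda>x s. E x s (m x s)"] conjI allI)
    have "decidable_in (\<lambda>_. 0) (\<lambda>p :: nat \<times> nat. E (fst p) (snd p) (m (fst p) (snd p)))"
      unfolding E_def D_def m_def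
      by (intro comp_intros decidable_in_comp[OF P(1)] decidable_in_comp[OF Q(1)]) blast
    then show "decidable_in (\<lambda>_. 0) (\<lambda>p. E (fst p) (snd p) (m (fst p) (snd p)))" .
    fix x
    \<comment> \<open>\<open>y\<close> witnesses membership through the Sigma_2 form, or
      non-membership through the negation of the Pi_2 form; one of the two kinds always
      exists.\<close>
    let ?W = "\<lambda>y. (\<forall>z. P (x, y, z)) \<or> (\<forall>z. \<not> Q (x, y, z))"
    define y0 where "y0 = (LEAST y. ?W y)"
    have "\<exists>y. ?W y" using P(2) Q(2) by blast
    then have y0: "?W y0" unfolding y0_def by (rule LeastI_ex)
    \<comment> \<open>Candidates below \<open>y0\<close> are refuted from some stage on. The last
      conjunct matters at \<open>y0\<close> itself: if it witnesses non-membership, \<open>E\<close>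
      may hold there for a while and has to be refuted too.\<close>
    have "\<exists>b. \<forall>s\<ge>b. (y < y0 \<longrightarrow> \<not> E x s y \<and> \<not> D x s y) \<and> (x \<notin> A \<longrightarrow> \<not> E x s y)" for y
    proof -
      have refuted: "\<exists>b. \<forall>s\<ge>b. \<not> (\<forall>z<s. R z)" if "\<not> (\<forall>z. R z)" for R :: "nat \<Rightarrow> bool"
        using that by (meson Suc_le_lessD)
      have 1: "\<exists>b. \<forall>s\<ge>b. x \<notin> A \<longrightarrow> \<not> E x s y"
      proof (cases "x \<in> A")
        case False
        then have "\<not> (\<forall>z. P (x, y, z))" using P(2) by blast
        from refuted[OF this] show ?thesis unfolding E_def by blast
      qed simp
      have 2: "\<exists>b. \<forall>s\<ge>b. y < y0 \<longrightarrow> \<not> E x s y" "\<exists>b. \<forall>s\<ge>b. y < y0 \<longrightarrow> \<not> D x s y"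
      proof -
        have wrong: "\<not> (\<forall>z. P (x, y, z))" "\<not> (\<forall>z. \<not> Q (x, y, z))" if less: "y < y0"
          using not_less_Least[OF less[unfolded y0_def]] by blast+
        have "\<exists>b. \<forall>s\<ge>b. \<not> E x s y" "\<exists>b. \<forall>s\<ge>b. \<not> D x s y" if "y < y0"
          unfolding E_def D_def by (rule refuted, rule wrong, rule that)+
        then show "\<exists>b. \<forall>s\<ge>b. y < y0 \<longrightarrow> \<not> E x s y" "\<exists>b. \<forall>s\<ge>b. y < y0 \<longrightarrow> \<not> D x s y"
          by (cases "y < y0"; simp)+
      qed
      obtain b1 b2 b3 where "\<forall>s\<ge>b1. x \<notin> A \<longrightarrow> \<not> E x s y"
        "\<forall>s\<ge>b2. y < y0 \<longrightarrow> \<not> E x s y" "\<forall>s\<ge>b3. y < y0 \<longrightarrow> \<not> D x s y" using 1 2 by blast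
      then show ?thesis by (intro exI[of _ "b1 + b2 + b3"]) auto
    qed
    then obtain b where b: "\<And>y s. b y \<le> s \<Longrightarrow>
      (y < y0 \<longrightarrow> \<not> E x s y \<and> \<not> D x s y) \<and> (x \<notin> A \<longrightarrow> \<not> E x s y)" by metis
    have "E x s (m x s) \<longleftrightarrow> x \<in> A" if s: "s \<ge> Suc y0 + (\<Sum>y\<le>y0. b y)" for s
    proof -
      have bs: "b y \<le> s" if "y \<le> y0" for y
        using member_le_sum[of y "{..y0}" b] that s by simp
      have m: "m x s = y0" unfolding m_def
      proof (rule Least_equality)
        show "s \<le> y0 \<or> E x s y0 \<or> D x s y0" using y0 unfolding E_def D_def by blast
        show "y0 \<le> y" if "s \<le> y \<or> E x s y \<or> D x s y" for y
        proof (rule ccontr)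
          assume "\<not> y0 \<le> y"
          then show False using that b[OF bs[of y]] s by simp
        qed
      qed
      have "E x s y0" if "x \<in> A"
      proof -
        have "\<not> (\<forall>z. \<not> Q (x, y0, z))" using that Q(2) by blast
        then show ?thesis using y0 unfolding E_def by blast
      qed
      then show ?thesis using b[OF bs[of y0]] m by auto
    qed
    then show "\<exists>s0. \<forall>s\<ge>s0. E x s (m x s) \<longleftrightarrow> x \<in> A" by blast
  qed
qed

lemma graph_image_delta2:
  assumes "computable f" "computable_rel r" "omega_iso r h"
  shows "delta2 (prod_encode ` graph_image h f)"
proof -
  have dec_r: "decidable_in (\<lambda>_. 0) (\<lambda>p. p \<in> r)"
    using assms(2) unfolding computable_rel_def computable_set_def computable_def
      recursive_in_char_fun_rel_iff .
  have cf: "computable_in (\<lambda>_. 0) f" using assms(1) by (simp add: computable_def computable_in_def)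
  have bij: "bij h" and iso: "\<And>x y. x < y \<longleftrightarrow> (h x, h y) \<in> r"
    using assms(3) unfolding omega_iso_def by blast+
  define cnt where "cnt t a = rec_nat 0 (\<lambda>z c. if (z, a) \<in> r then Suc c else c) t" for t a :: nat
  have cnt_card: "cnt t a = card {z. z < t \<and> (z, a) \<in> r}" for t a
  proof (induction t)
    case (Suc t)
    have "{z. z < Suc t \<and> (z, a) \<in> r} =
      (if (t, a) \<in> r then insert t {z. z < t \<and> (z, a) \<in> r} else {z. z < t \<and> (z, a) \<in> r})"
      by (auto simp: less_Suc_eq)
    then show ?case using Suc by (simp add: cnt_def)
  qed (simp add: cnt_def)
  have cnt_lim: "\<exists>s. \<forall>t\<ge>s. cnt t (h x) = x" for x
  proof -
    have pred: "{z. (z, h x) \<in> r} = h ` {..<x}"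
    proof (rule set_eqI)
      fix z
      obtain y where y: "z = h y" using bij by (metis bij_pointE)
      show "z \<in> {z. (z, h x) \<in> r} \<longleftrightarrow> z \<in> h ` {..<x}"
        using bij by (simp add: y iso[symmetric] bij_is_inj inj_image_mem_iff)
    qed
    obtain s where s: "\<forall>z\<in>h ` {..<x}. z < s"
      using finite_nat_set_iff_bounded by (metis finite_imageI finite_lessThan)
    have "cnt t (h x) = x" if "t \<ge> s" for t
    proof -
      have "z < t" if "(z, h x) \<in> r" for z
      proof -
        have "z \<in> h ` {..<x}" using that pred by blast
        then show ?thesis using s \<open>t \<ge> s\<close> by (meson order_less_le_trans)
      qed
      then have "{z. z < t \<and> (z, h x) \<in> r} = {z. (z, h x) \<in> r}" by blast
      also note pred
      finally show ?thesis
        by (simp add: cnt_card card_image[OF inj_on_subset[OF bij_is_inj[OF bij] subset_UNIV]])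
    qed
    then show ?thesis by blast
  qed
  define P where "P n t \<longleftrightarrow> cnt t (snd (prod_decode n)) = f (cnt t (fst (prod_decode n)))" for n t
  have lim: "\<exists>s. \<forall>t\<ge>s. P n t \<longleftrightarrow> n \<in> prod_encode ` graph_image h f" for n
  proof -
    obtain a b where ab: "n = prod_encode (a, b)" by (metis prod.exhaust prod_decode_inverse)
    obtain x y where "a = h x" "b = h y" using bij by (metis bij_pointE)
    then have n: "n = prod_encode (h x, h y)" using ab by simp
    obtain s u where "\<forall>t\<ge>s. cnt t (h x) = x" "\<forall>t\<ge>u. cnt t (h y) = y" using cnt_lim by meson
    then have "\<forall>t\<ge>max s u. P n t \<longleftrightarrow> y = f x" by (simp add: P_def n)
    moreover have "n \<in> prod_encode ` graph_image h f \<longleftrightarrow> y = f x"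
      using bij unfolding n graph_image_def
      by (auto simp: image_iff prod_encode_eq bij_is_inj inj_eq)
    ultimately show ?thesis by blast
  qed
  have "decidable_in (\<lambda>_. 0) (\<lambda>p. P (fst p) (snd p))"
  proof -
    have pd: "computable_in (\<lambda>_. 0) prod_decode"
      by (rule computable_in_eqI[of _ "\<lambda>n. dec n"])
        (simp add: dec_prod_def, intro comp_intros computable_in_dec)
    show ?thesis unfolding P_def cnt_def
      by (intro comp_intros computable_in_comp[OF cf] computable_in_comp[OF pd]
          decidable_in_comp[OF dec_r])
  qed
  note dec_P = decidable_in_comp2[OF this]
  \<comment> \<open>A convergent guess is true in the limit iff it is true from some stage on, and
    iff it is true at arbitrarily late stages; the former is a Sigma_2 condition, the latter a Pi_2
    condition.\<close>
  have "sigma2 (prod_encode ` graph_image h f)" unfolding sigma2_iff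
  proof (intro exI conjI)
    show "decidable_in (\<lambda>_. 0) (\<lambda>p :: nat \<times> nat \<times> nat. fst (snd p) \<le> snd (snd p) \<longrightarrow> P (fst p) (snd (snd p)))"
      by (intro comp_intros dec_P)
    show "prod_encode ` graph_image h f = {x. \<exists>y. \<forall>z. fst (snd (x, y, z)) \<le> snd (snd (x, y, z)) \<longrightarrow>
        P (fst (x, y, z)) (snd (snd (x, y, z)))}"
    proof (rule set_eqI)
      fix n
      obtain s where "\<forall>t\<ge>s. P n t \<longleftrightarrow> n \<in> prod_encode ` graph_image h f" using lim by blast
      then show "n \<in> prod_encode ` graph_image h f \<longleftrightarrow> n \<in> {x. \<exists>y. \<forall>z. fst (snd (x, y, z)) \<le> snd (snd (x, y, z)) \<longrightarrow>
        P (fst (x, y, z)) (snd (snd (x, y, z)))}" by simp (metis nat_le_linear)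
    qed
  qed
  moreover have "pi2 (prod_encode ` graph_image h f)" unfolding sigma2_iff
  proof (intro exI conjI)
    show "decidable_in (\<lambda>_. 0) (\<lambda>p :: nat \<times> nat \<times> nat. fst (snd p) \<le> snd (snd p) \<and> P (fst p) (snd (snd p)))"
      by (intro comp_intros dec_P)
    show "prod_encode ` graph_image h f = {x. \<forall>y. \<exists>z. fst (snd (x, y, z)) \<le> snd (snd (x, y, z)) \<and>
        P (fst (x, y, z)) (snd (snd (x, y, z)))}"
    proof (rule set_eqI)
      fix n
      obtain s where "\<forall>t\<ge>s. P n t \<longleftrightarrow> n \<in> prod_encode ` graph_image h f" using lim by blast
      then show "n \<in> prod_encode ` graph_image h f \<longleftrightarrow> n \<in> {x. \<forall>y. \<exists>z. fst (snd (x, y, z)) \<le> snd (snd (x, y, z)) \<and>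
        P (fst (x, y, z)) (snd (snd (x, y, z)))}" by simp (metis nat_le_linear)
    qed
  qed
  ultimately show ?thesis unfolding delta2_def by blast
qed

theorem theorem3:
  fixes f :: "nat \<Rightarrow> nat"
  assumes "computable f"
    and "block_function f"
    and "finite (f_types f)"
    and "\<not> almost_identity f"
  shows "degree_spectrum f = delta2_degrees"
proof
  show "degree_spectrum f \<subseteq> delta2_degrees"
    using graph_image_delta2[OF assms(1)] unfolding degree_spectrum_def delta2_degrees_def by blast
  show "delta2_degrees \<subseteq> degree_spectrum f"
  proof
    fix d assume "d \<in> delta2_degrees"
    then obtain A where A: "d = turing_degree A" "delta2 A" unfolding delta2_degrees_def by blast
    obtain M where "\<And>a. card (block f a) \<le> M" using block_card_bounded[OF assms(2,3)] by blast
    then interpret bounded_gaps f M by unfold_locales (rule boundary_near[OF assms(2)])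
    obtain i0 cx cy loc len off where scheme: "coding_scheme f M i0 cx cy loc len off"
      and comp: "\<And>orc. computable_in orc loc \<and> computable_in orc len \<and> computable_in orc off"
      using coding_scheme_exists[OF assms(4)] by blast
    obtain As :: "nat \<Rightarrow> nat \<Rightarrow> bool" where As: "decidable_in (\<lambda>_. 0) (\<lambda>p. As (fst p) (snd p))"
      "\<forall>n. \<exists>s0. \<forall>s\<ge>s0. As n s \<longleftrightarrow> n \<in> A" using limit_lemma[OF A(2)] by blast
    interpret coding_scheme f M i0 cx cy loc len off by (rule scheme)
    interpret computable_construction f M i0 cx cy loc len off As A
      by unfold_locales (use As comp assms(1) in \<open>simp_all add: computable_def computable_in_def\<close>)
    have "d = turing_degree (prod_encode ` graph_image h f)"
      unfolding A(1) turing_degree_eq_iff using graph_le le_graph by blast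
    then show "d \<in> degree_spectrum f"
      unfolding degree_spectrum_def using computable_rel_r omega_iso_r by blast
  qed
qed

end
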